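(* An orthogonal basis for $V_n$ (with respect to $\langle\cdot,\cdot\rangle_{\rm cher}$) is $\{Y_0,Y_{-1},Y_1,\dots,Y_{-n},Y_n\}$, where $$Y_{-m}=q^{m-1}t_3t_4(1-t_1t_2)(1-t_1t_3)(1-t_1t_4)R_m-t_1(1-t_1t_2t_3t_4q^{m-1})S_m\quad(m>0),$$ $$Y_{m}=q^m(1-t_1t_2)(1-t_1t_3)(1-t_1t_4)R_m+t_1(1-q^{m})S_m\quad(m\ge0).$$
   Context: Standing assumptions: $0<q<1$; $\mathbf t=(t_1,t_2,t_3,t_4)$ with each $t_i$ real and $|t_i|<1$; $n\ge0$ is an integer. Notation: $(a;q)_k=\prod_{i=0}^{k-1}(1-aq^i)$, $(a;q)_\infty=\prod_{i\ge0}(1-aq^i)$, $(a_1,\dots,a_r;q)_k=\prod_j(a_j;q)_k$, and ${}_4\phi_3(a_1,a_2,a_3,a_4;b_1,b_2,b_3;q,q)=\sum_{k\ge 0}\frac{(a_1,a_2,a_3,a_4;q)_k}{(q,b_1,b_2,b_3;q)_k}q^k$. $V_n$ is the $(2n+1)$-dimensional real vector space of Laurent polynomials spanned by $z^{-n},z^{1-n},\dots,z^{n}$. $R_n=R_n(z;\mathbf t\,|\,q)={}_4\phi_3(q^{-n},t_1t_2t_3t_4q^{n-1},t_1z,t_1/z;\;t_1t_2,t_1t_3,t_1t_4;q,q)$ for $n\ge0$. $S_0=0$ and for $n\ge1$, $S_n=S_n(z;\mathbf t\,|\,q)=z(1-t_3/z)(1-t_4/z)\;{}_4\phi_3(q^{1-n},t_1t_2t_3t_4q^{n},t_1z,qt_1/z;\;qt_1t_2,qt_1t_3,qt_1t_4;q,q)$.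 $w_{\rm cher}(z;\mathbf t\,|\,q)=\dfrac{(q,z^2,qz^{-2};q)_\infty}{\prod_{j=1}^4(t_jz;q)_\infty\,(t_3/z,t_4/z,qt_1/z,qt_2/z;q)_\infty}$ and, for Laurent polynomials $f,g$, $\langle f,g\rangle_{\rm cher}=\frac1{2\pi i}\oint_{|z|=1}f(z)g(z)\,w_{\rm cher}(z;\mathbf t\,|\,q)\,\frac{dz}{z}$. "Orthogonal basis" means a basis whose distinct elements are pairwise orthogonal for this form.
   Formalization: "Basis" is claimed only if t_1≠0 and t_3t_4(1-q^m)+q(1-t_1t_2t_3t_4q^{m-1})≠0 for 1≤m≤n; otherwise Y_m and Y_{-m} are linearly dependent (both 0 if t_1=0), so the claim fails. Membership in V_n and orthogonality are stated for all parameters. *)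

theory Defs
  imports "HOL-Complex_Analysis.Complex_Analysis" "HOL-Library.Function_Algebras"
begin

text \<open>Functions into a real vector space form a real vector space pointwise, so that the
  library's \<^term>\<open>span\<close> and \<^term>\<open>independent\<close> apply to functions.\<close>

instantiation "fun" :: (type, real_vector) real_vector
begin

definition scaleR_fun :: "real \<Rightarrow> ('a \<Rightarrow> 'b) \<Rightarrow> 'a \<Rightarrow> 'b" where
  "scaleR_fun c f = (\<lambda>x. c *\<^sub>R f x)"

instance
  by standard (simp_all add: scaleR_fun_def fun_eq_iff scaleR_add_right scaleR_add_left)

end

definition qpoch :: "'a::comm_ring_1 \<Rightarrow> 'a \<Rightarrow> nat \<Rightarrow> 'a" where
  "qpoch a q k = (\<Prod>i<k. 1 - a * q ^ i)"

definition qpoch_inf :: "'a::real_normed_field \<Rightarrow> 'a \<Rightarrow> 'a" where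
  "qpoch_inf a q = (\<Prod>i. 1 - a * q ^ i)"

definition phi43 ::
  "complex \<Rightarrow> complex \<Rightarrow> complex \<Rightarrow> complex \<Rightarrow> complex \<Rightarrow> complex \<Rightarrow> complex \<Rightarrow> complex \<Rightarrow> complex" where
  "phi43 a1 a2 a3 a4 b1 b2 b3 q =
     (\<Sum>k. (qpoch a1 q k * qpoch a2 q k * qpoch a3 q k * qpoch a4 q k)
          / (qpoch q q k * qpoch b1 q k * qpoch b2 q k * qpoch b3 q k) * q ^ k)"

definition R :: "real \<Rightarrow> real \<Rightarrow> real \<Rightarrow> real \<Rightarrow> real \<Rightarrow> nat \<Rightarrow> complex \<Rightarrow> complex" where
  "R t1 t2 t3 t4 q n z =
     phi43 (of_real (q powi (- int n))) (of_real (t1 * t2 * t3 * t4 * q powi (int n - 1)))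
           (of_real t1 * z) (of_real t1 / z)
           (of_real (t1 * t2)) (of_real (t1 * t3)) (of_real (t1 * t4)) (of_real q)"

definition S :: "real \<Rightarrow> real \<Rightarrow> real \<Rightarrow> real \<Rightarrow> real \<Rightarrow> nat \<Rightarrow> complex \<Rightarrow> complex" where
  "S t1 t2 t3 t4 q n z =
     (if n = 0 then 0
      else z * (1 - of_real t3 / z) * (1 - of_real t4 / z) *
        phi43 (of_real (q powi (1 - int n))) (of_real (t1 * t2 * t3 * t4 * q ^ n))
              (of_real t1 * z) (of_real (q * t1) / z)
              (of_real (q * t1 * t2)) (of_real (q * t1 * t3)) (of_real (q * t1 * t4)) (of_real q))"

text \<open>A Laurent polynomial is identified with the function it defines on the nonzero complex
  numbers, extended by the value 0 at 0. (Division by zero being total, the formulas for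
  \<^term>\<open>R\<close> and \<^term>\<open>S\<close> would otherwise give an irrelevant value at 0 that depends on the way a
  Laurent polynomial is written.)\<close>

definition laurent_monom :: "int \<Rightarrow> complex \<Rightarrow> complex" where
  "laurent_monom k z = (if z = 0 then 0 else z powi k)"

definition V :: "nat \<Rightarrow> (complex \<Rightarrow> complex) set" where
  "V n = span (laurent_monom ` {- int n..int n})"

definition Y :: "real \<Rightarrow> real \<Rightarrow> real \<Rightarrow> real \<Rightarrow> real \<Rightarrow> int \<Rightarrow> complex \<Rightarrow> complex" where
  "Y t1 t2 t3 t4 q k z =
     (if z = 0 then 0
      else if k < 0 then
        (let m = nat (- k) in
           of_real (q ^ (m - 1) * t3 * t4 * (1 - t1 * t2) * (1 - t1 * t3) * (1 - t1 * t4))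
             * R t1 t2 t3 t4 q m z
           - of_real (t1 * (1 - t1 * t2 * t3 * t4 * q ^ (m - 1))) * S t1 t2 t3 t4 q m z)
      else
        (let m = nat k in
           of_real (q ^ m * (1 - t1 * t2) * (1 - t1 * t3) * (1 - t1 * t4)) * R t1 t2 t3 t4 q m z
           + of_real (t1 * (1 - q ^ m)) * S t1 t2 t3 t4 q m z))"

definition w_cher :: "real \<Rightarrow> real \<Rightarrow> real \<Rightarrow> real \<Rightarrow> real \<Rightarrow> complex \<Rightarrow> complex" where
  "w_cher t1 t2 t3 t4 q z =
     (let p = (\<lambda>a. qpoch_inf a (of_real q)) in
        (p (of_real q) * p (z ^ 2) * p (of_real q * z powi (-2)))
        / ((p (of_real t1 * z) * p (of_real t2 * z) * p (of_real t3 * z) * p (of_real t4 * z))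
           * (p (of_real t3 / z) * p (of_real t4 / z)
              * p (of_real (q * t1) / z) * p (of_real (q * t2) / z))))"

definition cher ::
  "real \<Rightarrow> real \<Rightarrow> real \<Rightarrow> real \<Rightarrow> real \<Rightarrow> (complex \<Rightarrow> complex) \<Rightarrow> (complex \<Rightarrow> complex) \<Rightarrow> complex" where
  "cher t1 t2 t3 t4 q f g =
     1 / (2 * of_real pi * \<i>)
       * contour_integral (circlepath 0 1) (\<lambda>z. f z * g z * w_cher t1 t2 t3 t4 q z / z)"

definition orthogonal_basis ::
  "('a::real_vector \<Rightarrow> 'a \<Rightarrow> complex) \<Rightarrow> 'a set \<Rightarrow> 'a set \<Rightarrow> bool" where
  "orthogonal_basis form W B \<longleftrightarrow>
     independent B \<and> span B = W \<and> (\<forall>f\<in>B. \<forall>g\<in>B. f \<noteq> g \<longrightarrow> form f g = 0)"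

text \<open>If the coefficient of \<^term>\<open>S\<close> on the right vanishes, then \<^term>\<open>Y t1 t2 t3 t4 q (int m)\<close> and
  \<^term>\<open>Y t1 t2 t3 t4 q (- int m)\<close> are linearly dependent. This does happen inside the parameter
  domain (for \<^term>\<open>t1 = 0\<close>, and on a hypersurface where \<^term>\<open>t3 * t4 < 0\<close>), so the family can
  be a basis only where the coefficient is nonzero.\<close>

lemma Y_relation:
  assumes "m \<ge> 1" "z \<noteq> 0"
  shows "of_real (t3 * t4) * Y t1 t2 t3 t4 q (int m) z - of_real q * Y t1 t2 t3 t4 q (- int m) z
       = of_real (t1 * (t3 * t4 * (1 - q ^ m) + q * (1 - t1 * t2 * t3 * t4 * q ^ (m - 1))))
           * S t1 t2 t3 t4 q m z"
proof -
  obtain j where j: "m = Suc j" using assms by (cases m) auto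
  have [simp]: "nat (1 + int j) = Suc j" by simp
  show ?thesis using assms by (simp add: Y_def Let_def j algebra_simps)
qed

end

theory Submission
  imports Defs
begin

text \<open>
  Write \<open>C h\<close> for the integral of a Laurent polynomial \<open>h\<close> against the weight. With
  \<open>e(z) = (1 - t\<^sub>1z)(1 - t\<^sub>2z)/z\<close> and \<open>d(z) = (z - t\<^sub>3)(z - t\<^sub>4)/z\<close>, the functions \<open>e w\<close> and \<open>d w\<close>
  are antisymmetric under \<open>z \<mapsto> 1/z\<close> and \<open>z \<mapsto> q/z\<close> respectively, so \<open>C\<close> kills \<open>e f\<close> for \<open>f(1/z) = f(z)\<close>
  and, after moving the contour from \<open>|z| = 1\<close> to \<open>|z| = q\<close>, also \<open>d p\<close> for \<open>p(q/z) = p(z)\<close>.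
  Now \<open>R\<^sub>m\<close> is invariant under \<open>z \<mapsto> 1/z\<close> and \<open>S\<^sub>m = d P\<^sub>m\<^sub>-\<^sub>1\<close> with \<open>P\<^sub>m\<^sub>-\<^sub>1\<close> invariant under \<open>z \<mapsto> q/z\<close>.
  The lowering relation expresses \<open>R\<^sub>m(z) - R\<^sub>m(q/z)\<close> by \<open>P\<^sub>m\<^sub>-\<^sub>1\<close>; the raising relation, its adjoint,
  expresses the \<open>1/z\<close>-symmetric part of \<open>d P\<^sub>m\<^sub>-\<^sub>1\<close> modulo \<open>e\<close> by \<open>R\<^sub>m\<close>. Through them all pairings of
  \<open>R\<^sub>m, S\<^sub>m\<close> with \<open>R\<^sub>k, S\<^sub>k\<close> become explicit multiples of one symmetric quantity \<open>G m k\<close>, and the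
  symmetry of the pairing of \<open>R\<^sub>m\<close> with \<open>R\<^sub>k\<close> gives \<open>(\<lambda>\<^sub>m - \<lambda>\<^sub>k) G m k = 0\<close> (up to a factor \<open>t\<^sub>1\<^sup>2\<close>) for
  distinct eigenvalues \<open>\<lambda>\<^sub>m\<close>. No norm has to be evaluated: for equal indices the coefficients of
  \<open>Y\<^sub>m\<close> and \<open>Y\<^sub>-\<^sub>m\<close> make the multiple of \<open>G m m\<close> vanish. The basis property follows by comparing the
  coefficients of \<open>z\<^sup>m\<close> and \<open>z\<^sup>-\<^sup>m\<close>.
\<close>

section \<open>Lowering and raising relations\<close>

lemma qpoch_0 [simp]: "qpoch a q 0 = 1"
  by (simp add: qpoch_def)

lemma qpoch_Suc: "qpoch a q (Suc k) = qpoch a q k * (1 - a * q ^ k)"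
  by (simp add: qpoch_def)

lemma qpoch_Suc_shift: "qpoch a q (Suc k) = (1 - a) * qpoch (q * a) q k"
  unfolding qpoch_def by (simp add: prod.lessThan_Suc_shift mult_ac del: prod.lessThan_Suc)

lemma qpoch_shift: "(1 - a) * qpoch (q * a) q k = qpoch a q k * (1 - a * q ^ k)"
  by (metis qpoch_Suc qpoch_Suc_shift)

lemma of_real_qpoch: "of_real (qpoch a q k) = qpoch (of_real a) (of_real q) k"
  by (simp add: qpoch_def)

lemma qpoch_eq_0:
  assumes "m < k" "a * q ^ m = 1"
  shows "qpoch a q k = 0"
  using assms unfolding qpoch_def by (auto intro!: prod_zero)

lemma qpoch_nonzero:
  fixes a q :: real
  assumes "\<bar>a\<bar> < 1" "0 < q" "q < 1"
  shows "qpoch a q k \<noteq> 0"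
proof -
  have "a * q ^ i \<noteq> 1" for i
  proof -
    have "\<bar>a * q ^ i\<bar> \<le> \<bar>a\<bar> * 1"
      using assms unfolding abs_mult by (intro mult_left_mono) (auto simp: power_le_one)
    then show ?thesis using assms by auto
  qed
  then show ?thesis
    unfolding qpoch_def by (auto simp: prod_zero_iff)
qed

text \<open>The factor \<open>1 - q powi (- int N) * q ^ N = 0\<close> kills every term beyond
  \<open>N\<close>. The real coefficients are kept apart from the two symbols in \<open>x\<close>
  and \<open>y\<close>, which alone will depend on \<open>z\<close>.\<close>

lemma phi43_terminating:
  fixes q a b1 b2 b3 :: real
  assumes "q > 0"
  shows "phi43 (of_real (q powi (- int N))) (of_real a) x y (of_real b1) (of_real b2) (of_real b3) (of_real q)
    = (\<Sum>k\<le>N. of_real (qpoch (q powi (- int N)) q k * qpoch a q k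
          / (qpoch q q k * qpoch b1 q k * qpoch b2 q k * qpoch b3 q k) * q ^ k)
         * (qpoch x (of_real q) k * qpoch y (of_real q) k))"
proof -
  have "qpoch (of_real (q powi (- int N))) (of_real q :: complex) k = 0" if "k \<notin> {..N}" for k
  proof -
    have "qpoch (q powi (- int N)) q k = 0"
      using that assms by (intro qpoch_eq_0[of N]) (auto simp: power_int_minus)
    then show ?thesis by (metis of_real_0 of_real_qpoch)
  qed
  then show ?thesis
    unfolding phi43_def
    by (subst suminf_finite[of "{..N}"]) (auto simp: of_real_qpoch mult_ac intro!: sum.cong)
qed

section \<open>The parameter domain and the expansions of \<open>R\<close> and
  \<open>S\<close>\<close>

locale aw_params =
  fixes q t1 t2 t3 t4 :: real
  assumes q: "0 < q" "q < 1"
    and t: "\<bar>t1\<bar> < 1" "\<bar>t2\<bar> < 1" "\<bar>t3\<bar> < 1" "\<bar>t4\<bar> < 1"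
begin

lemma q_pow: "0 < q ^ k" "q ^ k \<le> 1"
  using q by (auto simp: power_le_one)

lemma abs_mult_less_1:
  fixes a b :: real
  assumes "\<bar>a\<bar> < 1" "\<bar>b\<bar> \<le> 1"
  shows "\<bar>a * b\<bar> < 1"
proof -
  have "\<bar>a * b\<bar> \<le> \<bar>a\<bar> * 1"
    unfolding abs_mult using assms by (intro mult_left_mono) auto
  then show ?thesis using assms by simp
qed

lemma t_pair: "\<bar>t1 * t2\<bar> < 1" "\<bar>t1 * t3\<bar> < 1" "\<bar>t1 * t4\<bar> < 1" "\<bar>t3 * t4\<bar> < 1"
  using t by (auto intro!: abs_mult_less_1)

lemma t_all: "\<bar>t1 * t2 * t3 * t4\<bar> < 1"
  using t by (intro abs_mult_less_1) auto

lemma t_all_pow: "1 - t1 * t2 * t3 * t4 * q ^ k \<noteq> 0"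
proof -
  have "\<bar>t1 * t2 * t3 * t4 * q ^ k\<bar> < 1"
    using t_all q_pow[of k] by (intro abs_mult_less_1[where b = "q ^ k"]) auto
  then show ?thesis by auto
qed

text \<open>The factor common to the coefficients of \<open>R\<close> in \<open>Y\<close>; it is
  also the constant in the lowering and raising relations.\<close>

definition K :: real where
  "K = (1 - t1 * t2) * (1 - t1 * t3) * (1 - t1 * t4)"

lemma K_nonzero: "K \<noteq> 0"
  using t_pair unfolding K_def by auto

text \<open>The Askey-Wilson basis, symmetric under \<open>z \<mapsto> 1 / z\<close>. In
  \<open>psi\<close> the shifted second symbol changes the symmetry to
  \<open>z \<mapsto> q / z\<close>.\<close>

definition phi :: "nat \<Rightarrow> complex \<Rightarrow> complex" where
  "phi k z = qpoch (of_real t1 * z) (of_real q) k * qpoch (of_real t1 / z) (of_real q) k"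

definition psi :: "nat \<Rightarrow> complex \<Rightarrow> complex" where
  "psi k z = qpoch (of_real t1 * z) (of_real q) k * qpoch (of_real (q * t1) / z) (of_real q) k"

definition R_coeff :: "nat \<Rightarrow> nat \<Rightarrow> real" where
  "R_coeff m k = qpoch (q powi (- int m)) q k * qpoch (t1 * t2 * t3 * t4 * q powi (int m - 1)) q k
     / (qpoch q q k * qpoch (t1 * t2) q k * qpoch (t1 * t3) q k * qpoch (t1 * t4) q k) * q ^ k"

definition P_coeff :: "nat \<Rightarrow> nat \<Rightarrow> real" where
  "P_coeff m k = qpoch (q powi (- int m)) q k * qpoch (t1 * t2 * t3 * t4 * q ^ Suc m) q k
     / (qpoch q q k * qpoch (q * t1 * t2) q k * qpoch (q * t1 * t3) q k * qpoch (q * t1 * t4) q k) * q ^ k"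

text \<open>The index of \<open>P\<close> is shifted: \<open>S (m + 1)\<close> is \<open>d\<close> times \<open>P m\<close>.\<close>

definition P :: "nat \<Rightarrow> complex \<Rightarrow> complex" where
  "P m z = (\<Sum>k\<le>m. of_real (P_coeff m k) * psi k z)"

definition d :: "complex \<Rightarrow> complex" where
  "d z = (z - of_real t3) * (z - of_real t4) / z"

abbreviation "RR \<equiv> R t1 t2 t3 t4 q"
abbreviation "SS \<equiv> S t1 t2 t3 t4 q"

lemma R_eq: "RR m z = (\<Sum>k\<le>m. of_real (R_coeff m k) * phi k z)"
  unfolding R_def R_coeff_def phi_def by (subst phi43_terminating[OF q(1)]) simp

lemma S_Suc:
  assumes "z \<noteq> 0"
  shows "SS (Suc m) z = d z * P m z"
proof -
  have [simp]: "1 - int (Suc m) = - int m" by simp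
  have "z * (1 - of_real t3 / z) * (1 - of_real t4 / z) = d z"
    using assms by (simp add: d_def field_simps)
  then show ?thesis
    unfolding S_def P_def P_coeff_def psi_def
    by (simp add: phi43_terminating[OF q(1)] del: of_real_mult of_real_power_int of_real_power of_real_divide)
qed

lemma phi_inverse: "phi k (1 / z) = phi k z"
  by (simp add: phi_def)

lemma psi_inverse: "z \<noteq> 0 \<Longrightarrow> psi k (of_real q / z) = psi k z"
  using q by (simp add: psi_def field_simps)

lemma R_inverse: "RR m (1 / z) = RR m z"
  by (simp add: R_eq phi_inverse)

lemma P_inverse: "z \<noteq> 0 \<Longrightarrow> P m (of_real q / z) = P m z"
  by (simp add: P_def psi_inverse)

section \<open>The lowering relation\<close>

definition lam :: "nat \<Rightarrow> real" where
  "lam m = (1 - q powi (- int m)) * (1 - t1 * t2 * t3 * t4 * q powi (int m - 1))"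

text \<open>Peeling one factor off each symbol shows that both terms are multiples of
  \<open>psi k z = ?A * ?B\<close>; the cofactors differ by the elementary identity
  \<open>3\<close>.\<close>

lemma phi_lowering:
  assumes z: "z \<noteq> 0"
  shows "phi (Suc k) z - phi (Suc k) (of_real q / z)
    = of_real (t1 / q * (1 - q ^ Suc k)) * (z - of_real q / z) * psi k z"
proof -
  let ?q = "of_real q :: complex" and ?t = "of_real t1 :: complex"
  let ?A = "qpoch (?t * z) ?q k" and ?B = "qpoch (?q * ?t / z) ?q k"
  have q0: "?q \<noteq> 0" using q by simp
  have 1: "phi (Suc k) z = ?A * (1 - ?t * z * ?q ^ k) * ((1 - ?t / z) * ?B)"
    unfolding phi_def qpoch_Suc[of "?t * z"] qpoch_Suc_shift[of "?t / z"] by simp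
  have "qpoch (?t * z / ?q) ?q (Suc k) = (1 - ?t * z / ?q) * ?A"
    unfolding qpoch_Suc_shift using q0 by simp
  moreover have "?t / (?q / z) = ?t * z / ?q" "?t * (?q / z) = ?q * ?t / z" by simp_all
  ultimately have 2: "phi (Suc k) (?q / z) = ?B * (1 - ?q * ?t / z * ?q ^ k) * ((1 - ?t * z / ?q) * ?A)"
    unfolding phi_def using qpoch_Suc[of "?q * ?t / z" ?q k] by (simp only: mult.commute)
  have 3: "(1 - ?t * z * ?q ^ k) * (1 - ?t / z) - (1 - ?q * ?t / z * ?q ^ k) * (1 - ?t * z / ?q)
      = ?t / ?q * (1 - ?q ^ Suc k) * (z - ?q / z)"
    using q0 z by (simp add: divide_simps) (simp add: algebra_simps)
  have "A * x * (y * B) - B * x' * (y' * A) = A * B * (x * y - x' * y')" for A B x y x' y' :: complex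
    by (simp add: algebra_simps)
  then have "phi (Suc k) z - phi (Suc k) (?q / z) =
    ?A * ?B * ((1 - ?t * z * ?q ^ k) * (1 - ?t / z) - (1 - ?q * ?t / z * ?q ^ k) * (1 - ?t * z / ?q))"
    unfolding 1 2 .
  then show ?thesis unfolding 3 psi_def by simp
qed

lemma qpoch_t_shift:
  fixes a :: real
  assumes "\<bar>a\<bar> < 1"
  shows "qpoch (q * a) q k = qpoch a q k * (1 - a * q ^ k) / (1 - a)"
    "qpoch (q * a) q k \<noteq> 0" "qpoch a q k \<noteq> 0"
proof -
  show "qpoch (q * a) q k = qpoch a q k * (1 - a * q ^ k) / (1 - a)"
    using qpoch_shift[of a q k] assms by (simp add: field_simps)
  have "\<bar>a * q\<bar> < 1" using assms q by (intro abs_mult_less_1) auto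
  then show "qpoch (q * a) q k \<noteq> 0" using q by (intro qpoch_nonzero) (auto simp: mult.commute)
  show "qpoch a q k \<noteq> 0" using assms q by (intro qpoch_nonzero)
qed

lemma q_powi_Suc: "q * q powi (- int (Suc m)) = q powi (- int m)"
  using q by (simp only: power_int_minus power_int_of_nat) (simp add: field_simps)

text \<open>Peeling the first factor off every symbol but \<open>qpoch q q\<close> turns the data of
  \<open>R_coeff (Suc m)\<close> into those of \<open>P_coeff m\<close>. The peeled factors make up
  \<open>lam (Suc m) / K\<close>, where \<open>lam\<close> is, up to sign, the eigenvalue of the
  Askey-Wilson operator.\<close>

lemma R_coeff_Suc:
  "R_coeff (Suc m) (Suc k) * ((1 - q ^ Suc k) / q) = lam (Suc m) / K * P_coeff m k"
proof -
  have 1: "qpoch (q powi (- int (Suc m))) q (Suc k) = (1 - q powi (- int (Suc m))) * qpoch (q powi (- int m)) q k"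
    unfolding qpoch_Suc_shift q_powi_Suc ..
  have e: "q powi (int (Suc m) - 1) = q ^ m" by simp
  have 2: "qpoch (t1 * t2 * t3 * t4 * q ^ m) q (Suc k)
     = (1 - t1 * t2 * t3 * t4 * q ^ m) * qpoch (t1 * t2 * t3 * t4 * q ^ Suc m) q k"
    unfolding qpoch_Suc_shift by (simp add: mult_ac)
  have 3: "qpoch q q (Suc k) = qpoch q q k * (1 - q ^ Suc k)" by (simp add: qpoch_Suc)
  have 4: "q ^ Suc k \<noteq> 1" using q by (metis power_Suc_less_one less_irrefl)
  have 5: "q * t1 * t2 = q * (t1 * t2)" "q * t1 * t3 = q * (t1 * t3)" "q * t1 * t4 = q * (t1 * t4)"
    by simp_all
  have 6: "1 - t1 * t2 \<noteq> 0" "1 - t1 * t3 \<noteq> 0" "1 - t1 * t4 \<noteq> 0" using t_pair by auto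
  have 7: "qpoch q q k \<noteq> 0" using q by (intro qpoch_nonzero) auto
  show ?thesis
    unfolding R_coeff_def P_coeff_def lam_def K_def e 1 2 3
    unfolding qpoch_Suc_shift[of "t1 * t2"] qpoch_Suc_shift[of "t1 * t3"] qpoch_Suc_shift[of "t1 * t4"] 5
    using 4 6 7 q t_pair[THEN qpoch_t_shift(2), of k]
    by (simp add: divide_simps)
qed

lemma lowering:
  assumes z: "z \<noteq> 0"
  shows "RR (Suc m) z - RR (Suc m) (of_real q / z)
     = of_real (t1 * lam (Suc m) / K) * (z - of_real q / z) * P m z"
proof -
  have c: "R_coeff (Suc m) (Suc k) * (t1 / q * (1 - q ^ Suc k)) = t1 * lam (Suc m) / K * P_coeff m k" for k
    using arg_cong[OF R_coeff_Suc[of m k], of "(*) t1"] by (simp only: mult_ac times_divide_eq_right times_divide_eq_left)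
  \<comment> \<open>The constant term drops out of the difference, so the sum runs over
    \<open>Suc k\<close> and matches the range of \<open>P m\<close>.\<close>
  have "phi 0 z = phi 0 (of_real q / z)" by (simp add: phi_def)
  then have "RR (Suc m) z - RR (Suc m) (of_real q / z)
      = (\<Sum>k\<le>m. of_real (R_coeff (Suc m) (Suc k)) * (phi (Suc k) z - phi (Suc k) (of_real q / z)))"
    by (simp add: R_eq sum.atMost_Suc_shift sum_subtractf right_diff_distrib del: sum.atMost_Suc)
  also have "\<dots> = (\<Sum>k\<le>m. of_real (t1 * lam (Suc m) / K) * (z - of_real q / z) * (of_real (P_coeff m k) * psi k z))"
  proof (rule sum.cong[OF refl])
    fix k
    have *: "of_real a * (of_real b * x * y) = of_real (a * b) * (x * y :: complex)" for a b x y
      by simp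
    show "of_real (R_coeff (Suc m) (Suc k)) * (phi (Suc k) z - phi (Suc k) (of_real q / z))
      = of_real (t1 * lam (Suc m) / K) * (z - of_real q / z) * (of_real (P_coeff m k) * psi k z)"
      unfolding phi_lowering[OF z] * c by simp
  qed
  also have "\<dots> = of_real (t1 * lam (Suc m) / K) * (z - of_real q / z) * P m z"
    unfolding P_def sum_distrib_left ..
  finally show ?thesis .
qed

section \<open>The raising relation\<close>

lemma raising_coeff:
  assumes "k \<le> Suc m"
  shows "P_coeff m k / q ^ k * ((1 - t1 * q ^ k * t2) * (1 - t1 * q ^ k * t3) * (1 - t1 * q ^ k * t4))
    - (case k of 0 \<Rightarrow> 0 | Suc j \<Rightarrow> P_coeff m j / q ^ j * (1 - t1 * q ^ j * t2 * t3 * t4))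
    = K * R_coeff (Suc m) k"
proof (cases k)
  case 0
  then show ?thesis by (simp add: P_coeff_def R_coeff_def K_def)
next
  case (Suc j)
  let ?t = "t1 * t2 * t3 * t4"
  define x where "x = q powi (- int m)"
  define A where "A = qpoch x q j"
  define B where "B = qpoch (?t * q ^ Suc m) q j"
  define Q where "Q = qpoch q q j"
  define B2 where "B2 = qpoch (q * (t1 * t2)) q j"
  define B3 where "B3 = qpoch (q * (t1 * t3)) q j"
  define B4 where "B4 = qpoch (q * (t1 * t4)) q j"
  have nz: "Q \<noteq> 0" "B2 \<noteq> 0" "B3 \<noteq> 0" "B4 \<noteq> 0"
    using q t_pair[THEN qpoch_t_shift(2), of j] qpoch_nonzero[of q q j]
    by (auto simp: Q_def B2_def B3_def B4_def)
  have 4: "q ^ Suc j \<noteq> 1" using q by (metis power_Suc_less_one less_irrefl)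
  have a1: "q * t1 * t2 = q * (t1 * t2)" "q * t1 * t3 = q * (t1 * t3)" "q * t1 * t4 = q * (t1 * t4)"
    by simp_all
  have 6: "1 - t1 * t2 \<noteq> 0" "1 - t1 * t3 \<noteq> 0" "1 - t1 * t4 \<noteq> 0" using t_pair by auto
  have x: "x * q ^ m = 1" using q by (simp add: x_def power_int_minus)
  have e1: "qpoch (q powi (- int (Suc m))) q (Suc j) = (1 - x / q) * A"
    using q unfolding qpoch_Suc_shift q_powi_Suc A_def by (simp add: x_def q_powi_Suc[of m, symmetric] del: of_nat_Suc)
  have e2: "qpoch (?t * q powi (int (Suc m) - 1)) q (Suc j) = (1 - ?t * q ^ m) * B"
    unfolding qpoch_Suc_shift B_def by (simp add: mult_ac)
  have 7: "1 - t1 * t2 * (q * q ^ j) \<noteq> 0" "1 - t1 * t3 * (q * q ^ j) \<noteq> 0" "1 - t1 * t4 * (q * q ^ j) \<noteq> 0"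
    using t_pair q_pow[of "Suc j"] abs_mult_less_1[of "t1*t2" "q * q ^ j"]
      abs_mult_less_1[of "t1*t3" "q * q ^ j"] abs_mult_less_1[of "t1*t4" "q * q ^ j"] by auto
  have p1: "P_coeff m j / q ^ j = A * B / (Q * B2 * B3 * B4)"
    using q by (simp add: P_coeff_def A_def B_def Q_def B2_def B3_def B4_def x_def a1)
  have p2: "P_coeff m (Suc j) / q ^ Suc j * ((1 - t1 * q ^ Suc j * t2) * (1 - t1 * q ^ Suc j * t3) * (1 - t1 * q ^ Suc j * t4))
     = A * (1 - x * q ^ j) * B * (1 - ?t * q ^ Suc m * q ^ j) / (Q * (1 - q ^ Suc j) * B2 * B3 * B4)"
    using q nz 4 7
    unfolding P_coeff_def a1 qpoch_Suc x_def[symmetric] A_def[symmetric] B_def[symmetric]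
      Q_def[symmetric] B2_def[symmetric] B3_def[symmetric] B4_def[symmetric]
    by (simp add: divide_simps) (simp add: mult_ac)
  have p3: "K * R_coeff (Suc m) (Suc j) = (1 - x / q) * A * (1 - ?t * q ^ m) * B / (Q * (1 - q ^ Suc j) * B2 * B3 * B4) * q ^ Suc j"
    using q nz 4 6 unfolding R_coeff_def e1 e2 K_def
    unfolding qpoch_Suc_shift[of "t1 * t2"] qpoch_Suc_shift[of "t1 * t3"] qpoch_Suc_shift[of "t1 * t4"]
       B2_def[symmetric] B3_def[symmetric] B4_def[symmetric] qpoch_Suc[of q] Q_def[symmetric]
    by (simp add: divide_simps)
  \<comment> \<open>What remains of the claim once the common factors are divided out. The terms in
    \<open>q ^ j * q ^ j\<close> cancel because \<open>x * q ^ m = 1\<close>.\<close>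
  have p4: "(1 - x * q ^ j) * (1 - ?t * q ^ Suc m * q ^ j) - (1 - q ^ Suc j) * (1 - t1 * q ^ j * t2 * t3 * t4)
    = (1 - x / q) * (1 - ?t * q ^ m) * q ^ Suc j"
  proof -
    have "x = 1 / q ^ m" using x q by (simp add: field_simps)
    then show ?thesis using q by (simp add: field_simps)
  qed
  have "A * (1 - x * q ^ j) * B * (1 - ?t * q ^ Suc m * q ^ j) / (Q * (1 - q ^ Suc j) * B2 * B3 * B4)
     - A * B / (Q * B2 * B3 * B4) * (1 - t1 * q ^ j * t2 * t3 * t4)
     = A * B / (Q * (1 - q ^ Suc j) * B2 * B3 * B4) *
       ((1 - x * q ^ j) * (1 - ?t * q ^ Suc m * q ^ j) - (1 - q ^ Suc j) * (1 - t1 * q ^ j * t2 * t3 * t4))"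
    using nz 4 by (simp add: divide_simps) algebra
  also have "\<dots> = K * R_coeff (Suc m) (Suc j)"
    unfolding p4 p3 by (simp add: mult_ac)
  finally show ?thesis unfolding Suc p2 p1 nat.case .
qed

text \<open>One shift makes \<open>(z - t1) * psi k z\<close> and
  \<open>(1 - t1 * z) * psi k (1 / z)\<close> multiples of \<open>phi k z\<close>. The left side is
  thus \<open>phi k z\<close> times a rational function, and \<open>phi (Suc k)\<close> is
  \<open>phi k\<close> times a quadratic factor, so only the rational identity \<open>4\<close> is
  left.\<close>

lemma phi_raising:
  assumes z: "z \<noteq> 0"
  shows "of_real t1 * ((z - of_real t1) * (z - of_real t2) * (z - of_real t3) * (z - of_real t4) / z\<^sup>2 * psi k z
     - (1 - of_real t1 * z) * (1 - of_real t2 * z) * (1 - of_real t3 * z) * (1 - of_real t4 * z) / z\<^sup>2 * psi k (1 / z))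
   = (z - 1 / z) * (of_real (((1 - t1 * q ^ k * t2) * (1 - t1 * q ^ k * t3) * (1 - t1 * q ^ k * t4)) / q ^ k) * phi k z
       - of_real ((1 - t1 * q ^ k * t2 * t3 * t4) / q ^ k) * phi (Suc k) z)"
proof -
  let ?q = "of_real q :: complex" and ?t = "of_real t1 :: complex"
  \<comment> \<open>With \<open>a\<close> in place of \<open>t1\<close>, identity \<open>4\<close>
    below is the case \<open>k = 0\<close> of the lemma.\<close>
  define a where "a = ?t * ?q ^ k"
  define u v w where "u = complex_of_real t2" "v = complex_of_real t3" "w = complex_of_real t4"
  note uvw = u_v_w_def
  have q0: "?q ^ k \<noteq> 0" using q by simp
  have ta: "?t = a / ?q ^ k" using q0 by (simp add: a_def)
  let ?A = "qpoch (?t * z) ?q k" and ?B = "qpoch (?t / z) ?q k"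
  have "(1 - ?t / z) * qpoch (?q * ?t / z) ?q k = ?B * (1 - ?t / z * ?q ^ k)"
    using qpoch_shift[of "?t / z" ?q k] by simp
  then have "z * (1 - ?t / z) * qpoch (?q * ?t / z) ?q k = z * (1 - ?t / z * ?q ^ k) * ?B"
    by (simp only: mult_ac)
  moreover have "z * (1 - ?t / z) = z - ?t" "z * (1 - ?t / z * ?q ^ k) = z - a"
    using z by (simp_all add: a_def field_simps)
  ultimately have 1: "(z - ?t) * psi k z = (z - a) * phi k z"
    by (simp add: psi_def phi_def)
  have "(1 - ?t * z) * qpoch (?q * ?t * z) ?q k = ?A * (1 - ?t * z * ?q ^ k)"
    using qpoch_shift[of "?t * z" ?q k] by (simp add: mult_ac)
  then have 2: "(1 - ?t * z) * psi k (1 / z) = (1 - a * z) * phi k z"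
    by (simp add: psi_def phi_def a_def mult_ac)
  have 3: "phi (Suc k) z = phi k z * ((1 - a * z) * (1 - a / z))"
    by (simp add: phi_def qpoch_Suc a_def mult_ac)
  have 4: "a * (((z - a) * (z - u) * (z - v) * (z - w) - (1 - a * z) * (1 - u * z) * (1 - v * z) * (1 - w * z)) / z\<^sup>2)
     = (z - 1 / z) * ((1 - a * u) * (1 - a * v) * (1 - a * w) - (1 - a * u * v * w) * ((1 - a * z) * (1 - a / z)))"
    using z by (simp add: divide_simps power2_eq_square) algebra
  have "?t * ((z - ?t) * (z - u) * (z - v) * (z - w) / z\<^sup>2 * psi k z
     - (1 - ?t * z) * (1 - u * z) * (1 - v * z) * (1 - w * z) / z\<^sup>2 * psi k (1 / z))
    = ?t / z\<^sup>2 * (((z - ?t) * psi k z) * ((z - u) * (z - v) * (z - w))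
        - ((1 - ?t * z) * psi k (1 / z)) * ((1 - u * z) * (1 - v * z) * (1 - w * z)))"
  proof -
    have "t * (x * a * b * c / y * p - x' * a' * b' * c' / y * p')
      = t / y * ((x * p) * (a * b * c) - (x' * p') * (a' * b' * c'))" for t x a b c x' a' b' c' y p p' :: complex
      by (simp add: algebra_simps diff_divide_distrib)
    then show ?thesis .
  qed
  also have "\<dots> = phi k z / ?q ^ k * (a * (((z - a) * (z - u) * (z - v) * (z - w) - (1 - a * z) * (1 - u * z) * (1 - v * z) * (1 - w * z)) / z\<^sup>2))"
  proof -
    have "?t / y * ((x * p) * (a' * b * c) - (x' * p) * (a'' * b' * c'))
       = p / ?q ^ k * (a * ((x * a' * b * c - x' * a'' * b' * c') / y))" for x a' b c x' a'' b' c' y p :: complex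
      unfolding ta by (simp add: algebra_simps diff_divide_distrib)
    then show ?thesis unfolding 1 2 .
  qed
  also have "\<dots> = (z - 1 / z) * ((1 - a * u) * (1 - a * v) * (1 - a * w) / ?q ^ k * phi k z - (1 - a * u * v * w) / ?q ^ k * phi (Suc k) z)"
  proof -
    have "f / Q * (w * (A - B * C)) = w * (A / Q * f - B / Q * (f * C))" for f Q w A B C :: complex
      by (simp add: algebra_simps diff_divide_distrib)
    then show ?thesis unfolding 4 3 .
  qed
  finally show ?thesis unfolding uvw a_def by simp
qed

text \<open>Summing \<open>phi_raising\<close> against \<open>P_coeff m\<close> contributes to
  \<open>phi k\<close> from the indices \<open>k\<close> and \<open>k - 1\<close>;
  \<open>raising_coeff\<close> recognises the total as a coefficient of \<open>R\<close>.\<close>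

lemma raising:
  assumes z: "z \<noteq> 0"
  shows "of_real t1 * ((z - of_real t1) * (z - of_real t2) * (z - of_real t3) * (z - of_real t4) / z\<^sup>2 * P m z
     - (1 - of_real t1 * z) * (1 - of_real t2 * z) * (1 - of_real t3 * z) * (1 - of_real t4 * z) / z\<^sup>2 * P m (1 / z))
   = of_real K * (z - 1 / z) * RR (Suc m) z"
proof -
  define X where "X = (z - of_real t1) * (z - of_real t2) * (z - of_real t3) * (z - of_real t4) / z\<^sup>2"
  define W where "W = (1 - of_real t1 * z) * (1 - of_real t2 * z) * (1 - of_real t3 * z) * (1 - of_real t4 * z) / z\<^sup>2"
  define a where "a k = P_coeff m k / q ^ k * ((1 - t1 * q ^ k * t2) * (1 - t1 * q ^ k * t3) * (1 - t1 * q ^ k * t4))" for k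
  define b where "b k = P_coeff m k / q ^ k * (1 - t1 * q ^ k * t2 * t3 * t4)" for k
  \<comment> \<open>The vanishing of \<open>a (Suc m)\<close> lets the unshifted sum be extended to
    the range \<open>k \<le> Suc m\<close> of the shifted one.\<close>
  have "qpoch (q powi (- int m)) q (Suc m) = 0"
    using q by (intro qpoch_eq_0[of m]) (auto simp: power_int_minus)
  then have a0: "a (Suc m) = 0" by (simp add: a_def P_coeff_def)
  have "of_real t1 * (X * P m z - W * P m (1 / z)) =
     (\<Sum>k\<le>m. of_real (P_coeff m k) * (of_real t1 * (X * psi k z - W * psi k (1 / z))))"
    unfolding P_def by (simp add: sum_distrib_left sum_subtractf right_diff_distrib mult_ac)
  also have "\<dots> = (\<Sum>k\<le>m. (z - 1 / z) * (of_real (a k) * phi k z - of_real (b k) * phi (Suc k) z))"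
  proof -
    have *: "of_real p * (w * (of_real (A / x) * f - of_real (B / x) * g))
      = w * (of_real (p / x * A) * f - of_real (p / x * B) * (g :: complex))" for p x A B w f g
      by (simp add: algebra_simps)
    show ?thesis
      unfolding X_def W_def phi_raising[OF z] a_def b_def by (intro sum.cong refl *)
  qed
  also have "\<dots> = (z - 1 / z) * ((\<Sum>k\<le>m. of_real (a k) * phi k z) - (\<Sum>k\<le>m. of_real (b k) * phi (Suc k) z))"
    by (simp add: sum_distrib_left sum_subtractf right_diff_distrib)
  also have "(\<Sum>k\<le>m. of_real (a k) * phi k z) = (\<Sum>k\<le>Suc m. of_real (a k) * phi k z)"
    by (simp add: a0)
  also have "(\<Sum>k\<le>m. of_real (b k) * phi (Suc k) z)
      = (\<Sum>k\<le>Suc m. of_real (case k of 0 \<Rightarrow> 0 | Suc j \<Rightarrow> b j) * phi k z)"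
    unfolding sum.atMost_Suc_shift by simp
  also have "(\<Sum>k\<le>Suc m. of_real (a k) * phi k z) - \<dots>
     = (\<Sum>k\<le>Suc m. of_real (a k - (case k of 0 \<Rightarrow> 0 | Suc j \<Rightarrow> b j)) * phi k z)"
    by (simp add: sum_subtractf left_diff_distrib del: sum.atMost_Suc)
  also have "\<dots> = (\<Sum>k\<le>Suc m. of_real (K * R_coeff (Suc m) k) * phi k z)"
    using raising_coeff[of _ m] unfolding a_def b_def by (intro sum.cong) auto
  also have "\<dots> = of_real K * RR (Suc m) z"
    unfolding R_eq by (simp add: sum_distrib_left mult_ac del: sum.atMost_Suc)
  finally show ?thesis unfolding X_def W_def by (simp add: mult_ac)
qed

end

section \<open>The weight and its reflections\<close>

lemma qpoch_inf_convergent: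
  fixes a q :: complex
  assumes "norm q < 1"
  shows "convergent_prod (\<lambda>i. 1 - a * q ^ i)"
proof -
  have "summable (\<lambda>i. norm a * norm q ^ i)"
    using assms by (intro summable_mult summable_geometric) auto
  then have "summable (\<lambda>i. norm (1 - a * q ^ i - 1))"
    by (simp add: norm_mult norm_power)
  then show ?thesis
    by (intro abs_convergent_prod_imp_convergent_prod summable_imp_abs_convergent_prod)
qed

lemma qpoch_inf_shift:
  fixes a q :: complex
  assumes "norm q < 1"
  shows "qpoch_inf a q = (1 - a) * qpoch_inf (q * a) q"
proof (rule LIMSEQ_unique)
  show "(\<lambda>n. \<Prod>i\<le>Suc n. 1 - a * q ^ i) \<longlonglongrightarrow> qpoch_inf a q"
    unfolding qpoch_inf_def
    by (rule LIMSEQ_Suc[OF convergent_prod_LIMSEQ[OF qpoch_inf_convergent[OF assms]]])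
  have "(\<lambda>n. \<Prod>i\<le>n. 1 - q * a * q ^ i) \<longlonglongrightarrow> qpoch_inf (q * a) q"
    unfolding qpoch_inf_def by (rule convergent_prod_LIMSEQ[OF qpoch_inf_convergent[OF assms]])
  then have "(\<lambda>n. (1 - a) * (\<Prod>i\<le>n. 1 - q * a * q ^ i)) \<longlonglongrightarrow> (1 - a) * qpoch_inf (q * a) q"
    by (intro tendsto_mult tendsto_const)
  moreover have "(\<Prod>i\<le>Suc n. 1 - a * q ^ i) = (1 - a) * (\<Prod>i\<le>n. 1 - q * a * q ^ i)" for n
    unfolding prod.atMost_Suc_shift by (simp add: mult_ac)
  ultimately show "(\<lambda>n. \<Prod>i\<le>Suc n. 1 - a * q ^ i) \<longlonglongrightarrow> (1 - a) * qpoch_inf (q * a) q"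
    by (simp only:)
qed

lemma qpoch_inf_nonzero:
  fixes a q :: complex
  assumes "norm q < 1" "norm a < 1"
  shows "qpoch_inf a q \<noteq> 0"
  unfolding qpoch_inf_def
proof (rule prodinf_nonzero[OF qpoch_inf_convergent[OF assms(1)]])
  fix i
  have "norm (a * q ^ i) \<le> norm a * 1"
    unfolding norm_mult norm_power using assms by (intro mult_left_mono power_le_one) auto
  then show "1 - a * q ^ i \<noteq> 0" using assms by auto
qed

text \<open>On each closed unit disc the factors differ from 1 by a geometric majorant, so the
  partial products converge uniformly.\<close>

lemma holomorphic_qpoch_inf:
  fixes q :: complex
  assumes "norm q < 1"
  shows "(\<lambda>a. qpoch_inf a q) holomorphic_on UNIV"
proof (rule holomorphic_uniform_sequence)
  fix a :: complex
  have "uniformly_convergent_on (cball a 1) (\<lambda>N a. \<Prod>n<N. 1 - a * q ^ n)"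
  proof (rule uniformly_convergent_on_prod')
    show "uniformly_convergent_on (cball a 1) (\<lambda>N a. \<Sum>n<N. norm (1 - a * q ^ n - 1))"
    proof (rule Weierstrass_m_test')
      fix n b assume "b \<in> cball a 1"
      then have "norm b \<le> norm a + 1"
        by (smt (verit) dist_norm mem_cball norm_minus_commute norm_triangle_sub)
      then show "norm (norm (1 - b * q ^ n - 1)) \<le> (norm a + 1) * norm q ^ n"
        by (simp add: norm_mult norm_power mult_right_mono)
    next
      show "summable (\<lambda>n. (norm a + 1) * norm q ^ n)"
        using assms by (intro summable_mult summable_geometric) auto
    qed
  qed (auto intro!: continuous_intros)
  then obtain g where g: "uniform_limit (cball a 1) (\<lambda>N a. \<Prod>n<N. 1 - a * q ^ n) g sequentially"
    by (auto simp: uniformly_convergent_on_def)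
  have "g b = qpoch_inf b q" if "b \<in> cball a 1" for b
  proof (rule LIMSEQ_unique)
    show "(\<lambda>N. \<Prod>n<N. 1 - b * q ^ n) \<longlonglongrightarrow> g b"
      by (rule tendsto_uniform_limitI[OF g that])
    have "(\<lambda>N. \<Prod>n\<le>N. 1 - b * q ^ n) \<longlonglongrightarrow> qpoch_inf b q"
      unfolding qpoch_inf_def by (rule convergent_prod_LIMSEQ[OF qpoch_inf_convergent[OF assms]])
    then show "(\<lambda>N. \<Prod>n<N. 1 - b * q ^ n) \<longlonglongrightarrow> qpoch_inf b q"
      by (simp add: LIMSEQ_lessThan_iff_atMost)
  qed
  with g have "uniform_limit (cball a 1) (\<lambda>N a. \<Prod>n<N. 1 - a * q ^ n) (\<lambda>b. qpoch_inf b q) sequentially"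
    by (metis (mono_tags, lifting) uniform_limit_cong')
  then show "\<exists>e>0. cball a e \<subseteq> UNIV \<and>
      uniform_limit (cball a e) (\<lambda>N a. \<Prod>n<N. 1 - a * q ^ n) (\<lambda>b. qpoch_inf b q) sequentially"
    by (intro exI[of _ 1]) auto
qed (auto intro!: holomorphic_intros)

lemma holomorphic_qpoch_inf_compose:
  assumes "norm (q :: complex) < 1" "f holomorphic_on A"
  shows "(\<lambda>z. qpoch_inf (f z) q) holomorphic_on A"
  using holomorphic_on_compose_gen[OF assms(2) holomorphic_qpoch_inf[OF assms(1)]] by (simp add: o_def)

section \<open>Contour integrals over circles and their symmetries\<close>

lemma circle_integral_eq:
  assumes "r > 0"
  shows "contour_integral (circlepath 0 r) (\<lambda>z. F z / z)
    = integral {0..1} (\<lambda>x. F (circlepath 0 r x) * (2 * of_real pi * \<i>))"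
  \<comment> \<open>On every circle about 0, \<open>dz / z\<close> is \<open>2 pi i dx\<close>, so
    the radius enters only through the argument of \<open>F\<close>.\<close>
  unfolding contour_integral_integral
  unfolding vector_derivative_circlepath
  by (intro integral_cong) (use assms in \<open>simp add: circlepath\<close>)

text \<open>Replacing the parameter \<open>x\<close> by \<open>1 - x\<close> inverts the points of
  the unit circle.\<close>

lemma circle_integral_inversion:
  assumes "continuous_on (sphere 0 1) F"
  shows "contour_integral (circlepath 0 1) (\<lambda>z. F (1 / z) / z) = contour_integral (circlepath 0 1) (\<lambda>z. F z / z)"
proof -
  define f where "f x = F (circlepath 0 1 x) * (2 * of_real pi * \<i>)" for x
  have "continuous_on {0..1} f"
    unfolding f_def
    by (intro continuous_intros continuous_on_compose2[OF assms])
       (auto simp: circlepath intro!: continuous_intros)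
  then have "(f has_integral integral {0..1} f) {0..1}"
    by (intro integrable_integral integrable_continuous_real)
  from has_integral_affinity01[OF this, of "-1" 1]
  have "((\<lambda>x. f (1 - x)) has_integral integral {0..1} f) {0..1}"
    by simp
  then have "integral {0..1} (\<lambda>x. f (1 - x)) = integral {0..1} f"
    by (rule integral_unique)
  moreover have "circlepath 0 1 (1 - x) = 1 / circlepath 0 1 x" for x
    by (simp add: circlepath algebra_simps exp_diff)
  ultimately show ?thesis
    unfolding circle_integral_eq[OF zero_less_one] f_def by (simp only:)
qed

lemma circle_integral_antisym:
  assumes "continuous_on (sphere 0 1) F" "\<And>z. norm z = 1 \<Longrightarrow> F (1 / z) = - F z"
  shows "contour_integral (circlepath 0 1) (\<lambda>z. F z / z) = 0"
proof -
  let ?I = "contour_integral (circlepath 0 1)"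
  have "?I (\<lambda>z. F z / z) = ?I (\<lambda>z. F (1 / z) / z)"
    using circle_integral_inversion[OF assms(1)] by simp
  also have "\<dots> = ?I (\<lambda>z. - (F z / z))"
    using assms(2) by (intro contour_integral_cong) auto
  also have "\<dots> = - ?I (\<lambda>z. F z / z)"
    by (rule contour_integral_neg)
  finally show ?thesis by simp
qed

text \<open>Cauchy's theorem moves the contour to radius \<open>q\<close>. Rescaling to radius 1
  turns \<open>F z\<close> into \<open>F (q * z) = - F (1 / z)\<close>, and inversion then equates
  the integral with its negative.\<close>

lemma annulus_integral_antisym:
  fixes q a b :: real
  assumes q: "0 < q" "q < 1" and ab: "0 \<le> a" "a < q" "1 < b"
    and hol: "F holomorphic_on {z. a < norm z \<and> norm z < b}"
    and anti: "\<And>z. q \<le> norm z \<Longrightarrow> norm z \<le> 1 \<Longrightarrow> F (of_real q / z) = - F z"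
  shows "contour_integral (circlepath 0 1) (\<lambda>z. F z / z) = 0"
proof -
  let ?A = "{z :: complex. a < norm z \<and> norm z < b}"
  let ?I = "\<lambda>r. contour_integral (circlepath 0 r)"
  have A: "open ?A"
    by (intro open_Collect_conj open_Collect_less continuous_intros)
  have hom: "homotopic_loops ?A (circlepath 0 1) (circlepath 0 q)"
  proof (rule homotopic_loops_linear)
    fix t x assume "(t :: real) \<in> {0..1}"
    \<comment> \<open>Points with the same parameter lie on one ray from 0, so the segment between
      them stays in \<open>q \<le> norm w \<le> 1\<close>.\<close>
    show "closed_segment (circlepath 0 1 t) (circlepath 0 q t) \<subseteq> ?A"
    proof
      fix w assume "w \<in> closed_segment (circlepath 0 1 t) (circlepath 0 q t)"
      then obtain u where u: "0 \<le> u" "u \<le> 1"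
        and w: "w = (1 - u) *\<^sub>R circlepath 0 1 t + u *\<^sub>R circlepath 0 q t"
        by (auto simp: closed_segment_def)
      have "w = of_real ((1 - u) + u * q) * exp (2 * of_real pi * \<i> * of_real t)"
        unfolding w by (simp add: circlepath scaleR_conv_of_real algebra_simps)
      moreover have "norm (exp (2 * of_real pi * \<i> * complex_of_real t)) = 1"
        by (simp add: norm_exp_eq_Re)
      ultimately have "norm w = \<bar>(1 - u) + u * q\<bar>"
        by (simp only: norm_mult norm_of_real mult_1_right)
      moreover have "u * (1 - q) \<le> 1 * (1 - q)" "0 \<le> u * (1 - q)"
        using u q by (intro mult_right_mono mult_nonneg_nonneg; simp)+
      then have "q \<le> (1 - u) + u * q" "(1 - u) + u * q \<le> 1"
        by (simp_all add: algebra_simps)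
      ultimately have "q \<le> norm w" "norm w \<le> 1" using q by simp_all
      then show "w \<in> ?A" using ab by simp
    qed
  qed auto
  have F1: "continuous_on (sphere 0 1) F"
    by (rule continuous_on_subset[OF holomorphic_on_imp_continuous_on[OF hol]]) (use q ab in auto)
  have "(\<lambda>z. F z / z) holomorphic_on ?A"
    using ab by (intro holomorphic_intros hol) auto
  from Cauchy_theorem_homotopic_loops[OF hom A this]
  have "?I 1 (\<lambda>z. F z / z) = ?I q (\<lambda>z. F z / z)"
    by simp
  also have "\<dots> = ?I 1 (\<lambda>z. F (of_real q * z) / z)"
    unfolding circle_integral_eq[OF zero_less_one] circle_integral_eq[OF q(1)]
    by (intro integral_cong) (simp add: circlepath)
  also have "\<dots> = ?I 1 (\<lambda>z. - (F (1 / z) / z))"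
  proof (intro contour_integral_cong)
    fix z :: complex assume "z \<in> path_image (circlepath 0 1)"
    then have z: "norm z = 1" by simp
    have "F (of_real q * z) = F (of_real q / (1 / z))" by simp
    also have "\<dots> = - F (1 / z)" using z q by (intro anti) (auto simp: norm_divide)
    finally show "F (of_real q * z) / z = - (F (1 / z) / z)" by simp
  qed simp
  also have "\<dots> = - ?I 1 (\<lambda>z. F (1 / z) / z)"
    by (rule contour_integral_neg)
  also have "\<dots> = - ?I 1 (\<lambda>z. F z / z)"
    using circle_integral_inversion[OF F1] by simp
  finally show ?thesis by simp
qed

section \<open>The weight, its multiple \<open>W\<close>, and their reflections\<close>

context aw_params
begin

abbreviation "w \<equiv> w_cher t1 t2 t3 t4 q"

abbreviation "pinf a \<equiv> qpoch_inf a (complex_of_real q)"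

text \<open>Unlike \<open>w\<close>, the function \<open>W = d w / z\<close> has no poles in the annulus \<open>q \<le> |z| \<le> 1\<close>.\<close>

definition W :: "complex \<Rightarrow> complex" where
  "W z = pinf (of_real q) * pinf (z ^ 2) * pinf (of_real q * z powi (-2))
     / ((pinf (of_real t1 * z) * pinf (of_real t2 * z) * pinf (of_real t3 * z) * pinf (of_real t4 * z))
       * (pinf (of_real (q * t1) / z) * pinf (of_real (q * t2) / z)
         * pinf (of_real (q * t3) / z) * pinf (of_real (q * t4) / z)))"

definition e :: "complex \<Rightarrow> complex" where
  "e z = (1 - of_real t1 * z) * (1 - of_real t2 * z) / z"

lemma pinf_shift: "pinf a = (1 - a) * pinf (of_real q * a)"
  using q by (intro qpoch_inf_shift) simp

lemma pinf_nonzero: "norm a < 1 \<Longrightarrow> pinf a \<noteq> 0"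
  using q by (intro qpoch_inf_nonzero) auto

lemma holomorphic_pinf [holomorphic_intros]:
  "f holomorphic_on A \<Longrightarrow> (\<lambda>z. pinf (f z)) holomorphic_on A"
  using q by (intro holomorphic_qpoch_inf_compose) auto

text \<open>The margin \<open>\<rho>\<close> widens the closed annulus between radii
  \<open>q\<close> and 1 to an open one, \<open>q * \<rho> < norm z < 1 / \<rho>\<close>, as
  Cauchy's theorem requires.\<close>

lemma ex_bound: "\<exists>\<rho>. 0 < \<rho> \<and> \<rho> < 1 \<and> (\<forall>a\<in>{t1, t2, t3, t4}. \<bar>a\<bar> < \<rho>)"
proof -
  define M where "M = max (max \<bar>t1\<bar> \<bar>t2\<bar>) (max \<bar>t3\<bar> \<bar>t4\<bar>)"
  have "M < 1" using t by (simp add: M_def)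
  then obtain \<rho> where "M < \<rho>" "\<rho> < 1" using dense by blast
  then show ?thesis by (intro exI[of _ \<rho>]) (auto simp: M_def)
qed

text \<open>The denominator of \<open>W\<close> is invariant under \<open>z \<mapsto> q / z\<close>.
  In the numerator the reflection exchanges the factors \<open>1 - q * z powi (-2)\<close> and
  \<open>1 - z ^ 2 / q\<close>, and the second is \<open>- z ^ 2 / q\<close> times the
  first.\<close>

lemma W_reflect:
  assumes z: "z \<noteq> 0" "norm (of_real q / z) \<le> 1" "norm z \<le> 1"
  shows "of_real q / z * W (of_real q / z) = - z * W z"
proof -
  let ?q = "of_real q :: complex"
  have q0: "?q \<noteq> 0" using q by simp
  have 1: "pinf ((?q / z) ^ 2) * (1 - ?q * z powi (-2)) = pinf (?q * z powi (-2))"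
  proof -
    have "?q * (?q * z powi (-2)) = (?q / z) ^ 2"
      by (simp add: power_int_minus power2_eq_square field_simps)
    then show ?thesis using pinf_shift[of "?q * z powi (-2)"] by simp
  qed
  have 2: "pinf (?q * (?q / z) powi (-2)) = (1 - z ^ 2 / ?q) * pinf (z ^ 2)"
  proof -
    have "?q * (?q / z) powi (-2) = z ^ 2 / ?q"
      using q0 z by (simp add: power_int_minus power2_eq_square field_simps)
    then show ?thesis using pinf_shift[of "z ^ 2 / ?q"] q0 by simp
  qed
  define N where "N = pinf (z ^ 2) * pinf ((?q / z) ^ 2)"
  define D where "D = (pinf (of_real t1 * z) * pinf (of_real t2 * z) * pinf (of_real t3 * z) * pinf (of_real t4 * z))
       * (pinf (of_real (q * t1) / z) * pinf (of_real (q * t2) / z)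
         * pinf (of_real (q * t3) / z) * pinf (of_real (q * t4) / z))"
  have a: "of_real t * (?q / z) = of_real (q * t) / z" "of_real (q * t) / (?q / z) = of_real t * z" for t
    using q0 by simp_all
  have "W (?q / z) = pinf ?q * (N * (1 - z ^ 2 / ?q)) / D"
    unfolding W_def 2 a N_def D_def by (simp add: mult_ac)
  moreover have "W z = pinf ?q * (N * (1 - ?q * z powi (-2))) / D"
    unfolding W_def 1[symmetric] N_def D_def by (simp add: mult_ac)
  moreover have "?q / z * (1 - z ^ 2 / ?q) = - z * (1 - ?q * z powi (-2))"
    using q0 z by (simp add: power_int_minus power2_eq_square field_simps)
  then have "?q / z * (pinf ?q * (N * (1 - z ^ 2 / ?q)) / D) = - z * (pinf ?q * (N * (1 - ?q * z powi (-2))) / D)"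
  proof -
    assume *: "?q / z * (1 - z ^ 2 / ?q) = - z * (1 - ?q * z powi (-2))"
    have "x * (p * (N * y) / D) = p * N / D * (x * y)" for x p y :: complex by simp
    then show ?thesis unfolding * by (simp only: *)
  qed
  ultimately show ?thesis by (simp only:)
qed

text \<open>On this annulus \<open>t * z\<close> and \<open>q * t / z\<close> have norm below 1 for
  each of the four parameters, so no factor of the denominator vanishes.\<close>

lemma W_holomorphic:
  assumes "0 < \<rho>" "\<forall>a\<in>{t1, t2, t3, t4}. \<bar>a\<bar> < \<rho>"
  shows "W holomorphic_on {z. q * \<rho> < norm z \<and> norm z < 1 / \<rho>}"
proof -
  let ?A = "{z. q * \<rho> < norm z \<and> norm z < 1 / \<rho>}"
  have nz: "z \<noteq> 0" if "z \<in> ?A" for z :: complex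
    using that assms q by auto (metis mult_pos_pos not_less_iff_gr_or_eq)
  have 1: "pinf (of_real a * z) \<noteq> 0" if "z \<in> ?A" "a \<in> {t1, t2, t3, t4}" for a z
  proof (rule pinf_nonzero)
    have "norm (of_real a * z) = \<bar>a\<bar> * norm z" by (simp add: norm_mult)
    also have "\<dots> \<le> \<rho> * norm z" using assms that by (intro mult_right_mono) auto
    also have "\<dots> < \<rho> * (1 / \<rho>)" using assms that by (intro mult_strict_left_mono) auto
    finally show "norm (of_real a * z) < 1" using assms by simp
  qed
  have 2: "pinf (of_real (q * a) / z) \<noteq> 0" if "z \<in> ?A" "a \<in> {t1, t2, t3, t4}" for a z
  proof (rule pinf_nonzero)
    have "q * \<bar>a\<bar> \<le> q * \<rho>" using assms that q by (intro mult_left_mono) auto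
    also have "\<dots> < norm z" using that by simp
    finally show "norm (of_real (q * a) / z) < 1" using nz[OF that(1)] q by (simp add: norm_divide norm_mult abs_mult)
  qed
  show ?thesis
    unfolding W_def using nz by (intro holomorphic_intros) (auto simp: 1 2 simp del: of_real_mult)
qed

lemma w_eq:
  assumes "norm z = 1"
  shows "w z = W z / ((1 - of_real t3 / z) * (1 - of_real t4 / z))"
    "1 - of_real t3 / z \<noteq> 0" "1 - of_real t4 / z \<noteq> 0" "1 - of_real t1 * z \<noteq> 0" "1 - of_real t2 * z \<noteq> 0"
proof -
  have "pinf (of_real a / z) = (1 - of_real a / z) * pinf (of_real (q * a) / z)" for a
    using pinf_shift[of "of_real a / z"] by simp
  then show "w z = W z / ((1 - of_real t3 / z) * (1 - of_real t4 / z))"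
    unfolding w_cher_def W_def Let_def by (simp add: mult_ac)
  have "norm (of_real a / z) < 1" "norm (of_real a * z) < 1" if "\<bar>a\<bar> < 1" for a
    using assms that by (auto simp: norm_divide norm_mult)
  with t show "1 - of_real t3 / z \<noteq> 0" "1 - of_real t4 / z \<noteq> 0" "1 - of_real t1 * z \<noteq> 0" "1 - of_real t2 * z \<noteq> 0"
    by (metis eq_iff_diff_eq_0 less_irrefl norm_one)+
qed

lemma W_continuous: "continuous_on (sphere 0 1) W"
proof -
  obtain \<rho> where \<rho>: "0 < \<rho>" "\<rho> < 1" "\<forall>a\<in>{t1, t2, t3, t4}. \<bar>a\<bar> < \<rho>" using ex_bound by blast
  have "q * \<rho> < 1 * 1" using q \<rho> by (intro mult_strict_mono) auto
  then show ?thesis using \<rho>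
    by (intro continuous_on_subset[OF holomorphic_on_imp_continuous_on[OF W_holomorphic[OF \<rho>(1,3)]]]) auto
qed

lemma w_continuous: "continuous_on (sphere 0 1) w"
proof -
  have "continuous_on (sphere 0 1) (\<lambda>z. W z / ((1 - of_real t3 / z) * (1 - of_real t4 / z)))"
    using w_eq by (intro continuous_intros W_continuous) auto
  then show ?thesis
    by (rule continuous_on_eq) (simp add: w_eq(1))
qed

lemma d_w: "norm z = 1 \<Longrightarrow> d z * w z = z * W z"
proof -
  assume z: "norm z = 1"
  then have "z \<noteq> 0" by auto
  then have "d z = z * ((1 - of_real t3 / z) * (1 - of_real t4 / z))"
    by (simp add: d_def field_simps)
  moreover define c where "c = (1 - of_real t3 / z) * (1 - of_real t4 / z)"
  moreover have "c \<noteq> 0" unfolding c_def using w_eq(2,3)[OF z] by simp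
  moreover have "z * c * (W z / c) = z * W z" if "c \<noteq> 0"
    using that by simp
  ultimately show ?thesis unfolding w_eq(1)[OF z] by simp
qed

text \<open>The numerator of \<open>e\<close> cancels the leading factors of the symbols in
  \<open>t1 * z\<close> and \<open>t2 * z\<close>. This leaves the inversion-invariant
  \<open>N\<close> times \<open>(1 - z ^ 2) / z\<close>, which changes sign under inversion.\<close>

lemma e_w:
  assumes z: "norm z = 1"
  shows "e (1 / z) * w (1 / z) = - (e z * w z)"
proof -
  let ?q = "of_real q :: complex"
  have z0: "z \<noteq> 0" using z by auto
  define N where "N = pinf ?q * pinf (?q * z ^ 2) * pinf (?q * z powi (-2))
      / (pinf (of_real (q * t1) * z) * pinf (of_real (q * t2) * z) * pinf (of_real t3 * z) * pinf (of_real t4 * z)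
        * (pinf (of_real (q * t1) / z) * pinf (of_real (q * t2) / z) * pinf (of_real t3 / z) * pinf (of_real t4 / z)))"
  have 1: "pinf (of_real a * z) = (1 - of_real a * z) * pinf (of_real (q * a) * z)"
    "pinf (of_real a / z) = (1 - of_real a / z) * pinf (of_real (q * a) / z)" for a
    using pinf_shift[of "of_real a * z"] pinf_shift[of "of_real a / z"] by (simp_all add: mult_ac)
  have 2: "pinf (z ^ 2) = (1 - z ^ 2) * pinf (?q * z ^ 2)"
     "pinf (z powi (-2)) = (1 - z powi (-2)) * pinf (?q * z powi (-2))"
    using pinf_shift by blast+
  have 3: "(1 / z) ^ 2 = z powi (-2)" "(1 / z) powi (-2) = z ^ 2"
    using z0 by (simp_all add: power_int_minus field_simps)
  have z': "norm (1 / z) = 1" using z by (simp add: norm_divide)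
  have n: "1 - of_real t1 * z \<noteq> 0" "1 - of_real t2 * z \<noteq> 0" "1 - of_real t1 / z \<noteq> 0" "1 - of_real t2 / z \<noteq> 0"
    using w_eq(4,5)[OF z] w_eq(4,5)[OF z'] by simp_all
  have 4: "of_real a * (1 / z) = of_real a / z" "of_real a / (1 / z) = of_real a * z" for a
    by simp_all
  \<comment> \<open>The cancellation is proved for variables so that the infinite products stay
    opaque; \<open>x\<close> and \<open>y\<close> stand for the two linear factors of
    \<open>e\<close>.\<close>
  have "x * y / u * (Q * (h * M) * K / (((x * a) * (y * b) * c * g) * (c' * g' * a' * b')))
      = h / u * (Q * M * K / (a * b * c * g * (a' * b' * c' * g')))"
    "x * y / (1 / u) * (Q * (h * K) * M / (((x * a') * (y * b') * c' * g') * (c * g * a * b)))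
      = h * u * (Q * M * K / (a * b * c * g * (a' * b' * c' * g')))"
    if "x \<noteq> 0" "y \<noteq> 0" for x y u Q h M K a b c g a' b' c' g' :: complex
    using that by (simp_all add: divide_simps)
  note aux = this(1)[OF n(1,2)] this(2)[OF n(3,4)]
  have A: "e z * w z = (1 - z ^ 2) / z * N"
    unfolding w_cher_def Let_def e_def N_def 2 1(1)[of t1] 1(1)[of t2] by (rule aux)
  have "e (1 / z) * w (1 / z) = (1 - z powi (-2)) * z * N"
    unfolding w_cher_def Let_def e_def N_def 3 4
    unfolding 2 1(2)[of t1] 1(2)[of t2] by (rule aux)
  moreover have "(1 - z powi (-2)) * z = - ((1 - z ^ 2) / z)"
    using z0 by (simp add: power_int_minus power2_eq_square field_simps)
  ultimately show ?thesis unfolding A by simp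
qed

section \<open>The integral functional \<open>C\<close>, which is \<open>cher\<close> without its
  constant factor\<close>

definition C :: "(complex \<Rightarrow> complex) \<Rightarrow> complex" where
  "C h = contour_integral (circlepath 0 1) (\<lambda>z. h z * w z / z)"

lemma C_cong: "(\<And>z. norm z = 1 \<Longrightarrow> f z = g z) \<Longrightarrow> C f = C g"
  unfolding C_def by (intro contour_integral_cong) auto

lemma C_integrable:
  assumes "continuous_on (sphere 0 1) f"
  shows "(\<lambda>z. f z * w z / z) contour_integrable_on circlepath 0 1"
  by (intro contour_integrable_continuous_circlepath)
     (auto intro!: continuous_intros assms w_continuous)

lemma C_add:
  assumes "continuous_on (sphere 0 1) f" "continuous_on (sphere 0 1) g"
  shows "C (\<lambda>z. f z + g z) = C f + C g"
  using contour_integral_add[OF assms[THEN C_integrable]]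
  by (simp add: C_def distrib_right add_divide_distrib)

lemma C_mult:
  assumes "continuous_on (sphere 0 1) f"
  shows "C (\<lambda>z. c * f z) = c * C f"
  using contour_integral_lmul[OF assms[THEN C_integrable], of c]
  by (simp add: C_def mult_ac)

lemma C_e:
  assumes "continuous_on (sphere 0 1) h" "\<And>z. norm z = 1 \<Longrightarrow> h (1 / z) = h z"
  shows "C (\<lambda>z. e z * h z) = 0"
  unfolding C_def
proof (rule circle_integral_antisym)
  have "continuous_on (sphere 0 1) e"
    unfolding e_def by (auto intro!: continuous_intros)
  then show "continuous_on (sphere 0 1) (\<lambda>z. e z * h z * w z)"
    by (intro continuous_intros assms w_continuous)
  fix z :: complex assume z: "norm z = 1"
  have "e (1 / z) * h (1 / z) * w (1 / z) = (e (1 / z) * w (1 / z)) * h (1 / z)" by (simp add: mult_ac)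
  also have "\<dots> = - (e z * h z * w z)" unfolding e_w[OF z] assms(2)[OF z] by (simp add: mult_ac)
  finally show "e (1 / z) * h (1 / z) * w (1 / z) = - (e z * h z * w z)" .
qed

text \<open>Since \<open>d * w\<close> is \<open>z * W z\<close> on the circle, the annulus argument
  applies. Holomorphy of \<open>p\<close> off 0 takes the place of continuity in \<open>C_e\<close>
  because the contour sweeps across the annulus.\<close>

lemma C_d:
  assumes "p holomorphic_on - {0}" "\<And>z. z \<noteq> 0 \<Longrightarrow> p (of_real q / z) = p z"
  shows "C (\<lambda>z. d z * p z) = 0"
proof -
  obtain \<rho> where \<rho>: "0 < \<rho>" "\<rho> < 1" "\<forall>a\<in>{t1, t2, t3, t4}. \<bar>a\<bar> < \<rho>" using ex_bound by blast
  have "C (\<lambda>z. d z * p z) = contour_integral (circlepath 0 1) (\<lambda>z. z * W z * p z / z)"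
    unfolding C_def
  proof (intro contour_integral_cong refl)
    fix z :: complex assume "z \<in> path_image (circlepath 0 1)"
    then have "norm z = 1" by simp
    from d_w[OF this] show "d z * p z * w z / z = z * W z * p z / z"
      by (metis mult.assoc mult.commute)
  qed
  also have "\<dots> = 0"
  proof (rule annulus_integral_antisym)
    show "0 < q" "q < 1" "0 \<le> q * \<rho>" "q * \<rho> < q" "1 < 1 / \<rho>" using q \<rho> by auto
    have "p holomorphic_on {z. q * \<rho> < norm z \<and> norm z < 1 / \<rho>}"
    proof (rule holomorphic_on_subset[OF assms(1)], safe)
      assume "q * \<rho> < norm (0 :: complex)"
      then show False using q \<rho> by (auto simp: mult_less_0_iff)
    qed
    then show "(\<lambda>z. z * W z * p z) holomorphic_on {z. q * \<rho> < norm z \<and> norm z < 1 / \<rho>}"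
      by (intro holomorphic_intros W_holomorphic \<rho>)
    fix z :: complex assume z: "q \<le> norm z" "norm z \<le> 1"
    then have z0: "z \<noteq> 0" using q by auto
    then have "norm (of_real q / z) \<le> 1" using z q by (simp add: norm_divide)
    from W_reflect[OF z0 this z(2)] assms(2)[OF z0]
    show "of_real q / z * W (of_real q / z) * p (of_real q / z) = - (z * W z * p z)"
      by (simp del: times_divide_eq_left)
  qed
  finally show ?thesis .
qed

end

section \<open>Orthogonality\<close>

context aw_params
begin

lemma q_neq_0: "complex_of_real q \<noteq> 0"
  using q by simp

lemma K_neq_0: "complex_of_real K \<noteq> 0"
  using K_nonzero by simp

lemma R_holomorphic: "RR m holomorphic_on - {0}"
proof -
  have "(\<lambda>z. \<Sum>k\<le>m. of_real (R_coeff m k) * phi k z) holomorphic_on - {0}"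
    unfolding phi_def qpoch_def by (intro holomorphic_intros) auto
  then show ?thesis by (simp add: R_eq[abs_def])
qed

lemma P_holomorphic: "P m holomorphic_on - {0}"
  unfolding P_def[abs_def] psi_def qpoch_def by (intro holomorphic_intros) auto

lemma d_holomorphic: "d holomorphic_on - {0}"
  unfolding d_def[abs_def] by (intro holomorphic_intros) auto

lemma continuous_on_circle: "f holomorphic_on - {0} \<Longrightarrow> continuous_on (sphere 0 1) f"
  by (erule continuous_on_subset[OF holomorphic_on_imp_continuous_on]) auto

lemmas R_continuous = continuous_on_circle[OF R_holomorphic]
  and P_continuous = continuous_on_circle[OF P_holomorphic]
  and d_continuous = continuous_on_circle[OF d_holomorphic]

lemma circle_nonzero: "norm z = 1 \<Longrightarrow> z \<noteq> (0 :: complex)"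
  by auto

section \<open>Pairings of \<open>R\<close> and \<open>S\<close> as multiples of
  \<open>G\<close>\<close>

definition G :: "nat \<Rightarrow> nat \<Rightarrow> complex" where
  "G m k = C (\<lambda>z. d z * ((z - of_real q / z) * P m z * P k z))"

lemma G_commute: "G m k = G k m"
  unfolding G_def by (simp add: mult_ac)

text \<open>Splits \<open>h\<close> into parts even and odd under \<open>z \<mapsto> q / z\<close>:
  \<open>C_d\<close> removes the even part \<open>f\<close>, and the odd part is a multiple of the
  integrand of \<open>G\<close>.\<close>

lemma C_d_split:
  assumes "f holomorphic_on - {0}" "\<And>z. z \<noteq> 0 \<Longrightarrow> f (of_real q / z) = f z"
    and "\<And>z. z \<noteq> 0 \<Longrightarrow> h z = f z + c * ((z - of_real q / z) * P m z * P k z)"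
  shows "C (\<lambda>z. d z * h z) = c * G m k"
proof -
  have "C (\<lambda>z. d z * h z) = C (\<lambda>z. d z * f z + c * (d z * ((z - of_real q / z) * P m z * P k z)))"
    by (intro C_cong) (simp add: assms(3)[OF circle_nonzero] algebra_simps)
  also have "\<dots> = C (\<lambda>z. d z * f z) + c * G m k"
    unfolding G_def
    by (subst C_add C_mult; (intro continuous_intros d_continuous P_continuous continuous_on_circle[OF assms(1)])?; auto)+
  also have "C (\<lambda>z. d z * f z) = 0"
    by (rule C_d[OF assms(1,2)])
  finally show ?thesis by simp
qed

lemma R_0: "RR 0 z = 1"
  by (simp add: R_eq phi_def R_coeff_def)

lemma C_R0_S: "C (\<lambda>z. RR 0 z * SS (Suc k) z) = 0"
proof -
  have "C (\<lambda>z. RR 0 z * SS (Suc k) z) = C (\<lambda>z. d z * P k z)"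
    by (intro C_cong) (simp add: R_0 S_Suc circle_nonzero)
  also have "\<dots> = 0"
    by (intro C_d P_holomorphic P_inverse)
  finally show ?thesis .
qed

text \<open>Here \<open>f\<close> is the even part of \<open>RR (Suc m)\<close> times
  \<open>P k\<close>; the odd part is half the difference computed by
  \<open>lowering\<close>.\<close>

lemma C_R_S: "C (\<lambda>z. RR (Suc m) z * SS (Suc k) z) = of_real (t1 * lam (Suc m) / K) / 2 * G m k"
proof -
  let ?q = "of_real q :: complex"
  define f where "f z = (RR (Suc m) z + RR (Suc m) (?q / z)) / 2 * P k z" for z
  have "C (\<lambda>z. RR (Suc m) z * SS (Suc k) z) = C (\<lambda>z. d z * (RR (Suc m) z * P k z))"
    by (intro C_cong) (simp add: S_Suc circle_nonzero)
  also have "\<dots> = of_real (t1 * lam (Suc m) / K) / 2 * G m k"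
  proof (rule C_d_split)
    have "(\<lambda>z. RR (Suc m) (?q / z)) holomorphic_on - {0}"
      using q_neq_0 by (intro holomorphic_on_compose_gen[OF _ R_holomorphic, unfolded o_def] holomorphic_intros) auto
    then show "f holomorphic_on - {0}"
      unfolding f_def by (intro holomorphic_intros R_holomorphic P_holomorphic) auto
    fix z :: complex assume z: "z \<noteq> 0"
    then show "f (?q / z) = f z"
      using q_neq_0 by (simp add: f_def P_inverse add.commute)
    have "RR (Suc m) z = (RR (Suc m) z + RR (Suc m) (?q / z)) / 2 + (RR (Suc m) z - RR (Suc m) (?q / z)) / 2"
      by (simp add: field_simps)
    then have "RR (Suc m) z = (RR (Suc m) z + RR (Suc m) (?q / z)) / 2
        + of_real (t1 * lam (Suc m) / K) * (z - ?q / z) * P m z / 2"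
      unfolding lowering[OF z] .
    from arg_cong[OF this, of "\<lambda>x. x * P k z"]
    show "RR (Suc m) z * P k z = f z + of_real (t1 * lam (Suc m) / K) / 2 * ((z - ?q / z) * P m z * P k z)"
      unfolding f_def by (simp add: distrib_right mult.assoc del: of_real_mult of_real_divide)
  qed
  finally show ?thesis .
qed

text \<open>One factor \<open>d\<close> belongs to the pattern of \<open>C_d_split\<close>. The
  other, \<open>z - (t3 + t4) + t3 * t4 / z\<close>, has even part \<open>s\<close> and an odd part
  proportional to \<open>z - q / z\<close>.\<close>

lemma C_S_S: "C (\<lambda>z. SS (Suc m) z * SS (Suc k) z) = of_real (1 - t3 * t4 / q) / 2 * G m k"
proof -
  let ?q = "of_real q :: complex"
  define s where "s z = of_real (1 + t3 * t4 / q) / 2 * (z + ?q / z) - of_real (t3 + t4)" for z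
  have "C (\<lambda>z. SS (Suc m) z * SS (Suc k) z) = C (\<lambda>z. d z * (d z * P m z * P k z))"
    by (intro C_cong) (simp add: S_Suc circle_nonzero mult_ac)
  also have "\<dots> = of_real (1 - t3 * t4 / q) / 2 * G m k"
  proof (rule C_d_split)
    show "(\<lambda>z. s z * P m z * P k z) holomorphic_on - {0}"
      unfolding s_def by (intro holomorphic_intros P_holomorphic) auto
    fix z :: complex assume z: "z \<noteq> 0"
    then show "s (?q / z) * P m (?q / z) * P k (?q / z) = s z * P m z * P k z"
      using q_neq_0 by (simp add: s_def P_inverse add.commute)
    have "d z = s z + of_real (1 - t3 * t4 / q) / 2 * (z - ?q / z)"
      using z q by (simp add: d_def s_def field_simps)
    from arg_cong[OF this, of "\<lambda>x. x * (P m z * P k z)"]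
    show "d z * P m z * P k z = s z * P m z * P k z + of_real (1 - t3 * t4 / q) / 2 * ((z - ?q / z) * P m z * P k z)"
      by (simp add: distrib_right mult.assoc del: of_real_mult of_real_divide of_real_diff)
  qed
  finally show ?thesis .
qed

lemma e_nonzero: "norm z = 1 \<Longrightarrow> e z \<noteq> 0"
  using w_eq(4,5)[of z] circle_nonzero[of z] by (auto simp: e_def)

text \<open>The difference of \<open>t1 (1 - t1 t2) d P\<close> and \<open>K R\<close> is \<open>e\<close> times a symmetric function. Dividing by
  \<open>e\<close>, which has no zeros on the circle, rather than by \<open>z - 1/z\<close> avoids the points \<open>z = 1, -1\<close>.\<close>

lemma C_R_R:
  "of_real K * C (\<lambda>z. RR k z * RR (Suc m) z) = of_real (t1 * (1 - t1 * t2)) * C (\<lambda>z. RR k z * SS (Suc m) z)"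
proof -
  define c :: complex where "c = of_real (t1 * (1 - t1 * t2))"
  define F where "F z = d z * P m z" for z
  define h where "h z = (c * F z - of_real K * RR (Suc m) z) / e z" for z
  have F: "continuous_on (sphere 0 1) F"
    unfolding F_def by (intro continuous_intros d_continuous P_continuous)
  have h: "continuous_on (sphere 0 1) h"
    unfolding h_def
  proof (intro continuous_intros F R_continuous)
    show "continuous_on (sphere 0 1) e"
      unfolding e_def by (auto intro!: continuous_intros)
  qed (use e_nonzero in auto)
  have sym: "h (1 / z) = h z" if z: "norm z = 1" for z
  proof -
    have z0: "z \<noteq> 0" and z': "norm (1 / z) = 1" using z by (auto simp: norm_divide)
    have E: "(z - of_real t1) * (z - of_real t2) * (z - of_real t3) * (z - of_real t4) / z\<^sup>2 * P m z = e (1 / z) * F z"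
      "(1 - of_real t1 * z) * (1 - of_real t2 * z) * (1 - of_real t3 * z) * (1 - of_real t4 * z) / z\<^sup>2 * P m (1 / z) = e z * F (1 / z)"
      using z0 by (simp_all add: e_def F_def d_def field_simps power2_eq_square)
    \<comment> \<open>This trades the factor \<open>z - 1 / z\<close> in \<open>raising\<close> for
      \<open>e z - e (1 / z)\<close>, which gives the symmetry of \<open>h\<close> in
      cross-multiplied form.\<close>
    have "e z - e (1 / z) = - of_real (1 - t1 * t2) * (z - 1 / z)"
      using z0 by (simp add: e_def field_simps)
    then have "of_real K * RR (Suc m) z * (e z - e (1 / z)) = - of_real (1 - t1 * t2) * (of_real K * (z - 1 / z) * RR (Suc m) z)"
      by (simp add: mult_ac)
    also have "\<dots> = c * (e z * F (1 / z) - e (1 / z) * F z)"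
      unfolding raising[OF z0, symmetric] E c_def by (simp add: algebra_simps)
    finally have "(c * F (1 / z) - of_real K * RR (Suc m) z) * e z = (c * F z - of_real K * RR (Suc m) z) * e (1 / z)"
      by (simp add: algebra_simps)
    then show ?thesis
      unfolding h_def R_inverse using e_nonzero[OF z] e_nonzero[OF z'] by (simp add: frac_eq_eq)
  qed
  have "c * C (\<lambda>z. RR k z * SS (Suc m) z) = C (\<lambda>z. c * (RR k z * F z))"
    by (subst C_mult) (auto intro!: continuous_intros R_continuous d_continuous P_continuous C_cong simp: S_Suc F_def circle_nonzero)
  also have "\<dots> = C (\<lambda>z. of_real K * (RR k z * RR (Suc m) z) + e z * (RR k z * h z))"
  proof (intro C_cong)
    fix z :: complex assume z: "norm z = 1"
    have "e z * h z = c * F z - of_real K * RR (Suc m) z"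
      using e_nonzero[OF z] by (simp add: h_def)
    from arg_cong[OF this, of "\<lambda>x. RR k z * x"]
    show "c * (RR k z * F z) = of_real K * (RR k z * RR (Suc m) z) + e z * (RR k z * h z)"
      by (simp add: algebra_simps)
  qed
  also have "\<dots> = of_real K * C (\<lambda>z. RR k z * RR (Suc m) z) + C (\<lambda>z. e z * (RR k z * h z))"
  proof -
    have "continuous_on (sphere 0 1) e"
      unfolding e_def by (auto intro!: continuous_intros)
    then show ?thesis
      by (subst C_add C_mult; (intro continuous_intros R_continuous h)?; auto)+
  qed
  also have "C (\<lambda>z. e z * (RR k z * h z)) = 0"
    by (rule C_e) (auto intro!: continuous_intros R_continuous h simp: sym R_inverse)
  finally show ?thesis unfolding c_def by simp
qed

text \<open>With \<open>x = q ^ m\<close> and \<open>y = q ^ k\<close> the difference factors as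
  \<open>(x - y) * (1 - t1 * t2 * t3 * t4 * q * x * y) / (q * x * y)\<close>, and no factor
  vanishes.\<close>

lemma lam_inj:
  assumes "m < k"
  shows "lam (Suc m) \<noteq> lam (Suc k)"
proof -
  let ?t = "t1 * t2 * t3 * t4"
  define x y where "x = q ^ m" "y = q ^ k"
  have xy: "0 < x" "0 < y" "y < x"
    using q assms by (auto simp: x_y_def power_strict_decreasing)
  have l: "lam (Suc j) = (1 - 1 / (q * q ^ j)) * (1 - ?t * q ^ j)" for j
  proof -
    have "q powi (- int (Suc j)) = 1 / (q * q ^ j)"
      using q_powi_Suc[of j] q by (simp add: power_int_minus field_simps)
    then show ?thesis unfolding lam_def by simp
  qed
  have "1 - ?t * (q * x * y) \<noteq> 0"
    using t_all_pow[of "Suc (m + k)"] by (simp add: x_y_def power_add mult_ac)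
  moreover have "lam (Suc m) - lam (Suc k) = (x - y) * (1 - ?t * (q * x * y)) / (q * x * y)"
    unfolding l x_y_def[symmetric] using q xy by (simp add: field_simps)
  ultimately show ?thesis using xy q by auto
qed

text \<open>The pairing of \<open>RR (Suc m)\<close> with \<open>RR (Suc k)\<close>, evaluated in
  both orders, gives the same multiple of \<open>t1 * t1 * lam (Suc m) * G m k\<close> and of
  \<open>t1 * t1 * lam (Suc k) * G m k\<close>. A factor \<open>t1\<close> stays in the conclusion
  because \<open>t1 = 0\<close> is allowed.\<close>

lemma G_offdiag:
  assumes "m \<noteq> k"
  shows "of_real t1 * G m k = 0"
proof -
  have *: "of_real K * C (\<lambda>z. RR (Suc i) z * RR (Suc j) z)
    = of_real (t1 * (1 - t1 * t2)) * (of_real (t1 * lam (Suc i) / K) / 2 * G i j)" for i j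
    unfolding C_R_R C_R_S ..
  have "C (\<lambda>z. RR (Suc m) z * RR (Suc k) z) = C (\<lambda>z. RR (Suc k) z * RR (Suc m) z)"
    by (simp add: mult.commute)
  then have "of_real (t1 * (1 - t1 * t2)) * (of_real (t1 * lam (Suc m) / K) / 2 * G m k)
     = of_real (t1 * (1 - t1 * t2)) * (of_real (t1 * lam (Suc k) / K) / 2 * G m k)"
    using *[of m k] *[of k m] G_commute[of k m] by metis
  moreover have "1 - t1 * t2 \<noteq> 0" using t_pair by auto
  moreover have "lam (Suc m) \<noteq> lam (Suc k)"
    using lam_inj[of m k] lam_inj[of k m] assms by (metis nat_neq_iff)
  ultimately show ?thesis
    using K_nonzero by (simp flip: of_real_mult of_real_diff of_real_divide) auto
qed

section \<open>Pairings of the functions \<open>Y\<close>\<close>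

definition \<alpha> :: "int \<Rightarrow> real" where
  "\<alpha> i = (if i < 0 then q ^ (nat (- i) - 1) * t3 * t4 * K else q ^ nat i * K)"

definition \<beta> :: "int \<Rightarrow> real" where
  "\<beta> i = (if i < 0 then - (1 - t1 * t2 * t3 * t4 * q ^ (nat (- i) - 1)) else 1 - q ^ nat i)"

abbreviation "YY \<equiv> Y t1 t2 t3 t4 q"

text \<open>The factor \<open>t1\<close> of the coefficient of \<open>S\<close> stays outside
  \<open>\<beta>\<close>, since the off-diagonal pairings with \<open>S\<close> are shown to vanish
  only after multiplication by \<open>t1\<close>.\<close>

lemma Y_eq:
  "z \<noteq> 0 \<Longrightarrow> YY i z = of_real (\<alpha> i) * RR (nat \<bar>i\<bar>) z + of_real (t1 * \<beta> i) * SS (nat \<bar>i\<bar>) z"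
  by (simp add: Y_def Let_def \<alpha>_def \<beta>_def K_def algebra_simps)

lemma S_continuous: "continuous_on (sphere 0 1) (SS m)"
proof (cases m)
  case 0
  then show ?thesis by (simp add: S_def[abs_def])
next
  case (Suc k)
  have "continuous_on (sphere 0 1) (\<lambda>z. d z * P k z)"
    by (intro continuous_intros d_continuous P_continuous)
  then show ?thesis
    by (rule continuous_on_eq) (simp add: Suc S_Suc circle_nonzero)
qed

lemma C_Y_Y:
  fixes i j :: int
  defines "a \<equiv> nat \<bar>i\<bar>" and "b \<equiv> nat \<bar>j\<bar>"
  shows "C (\<lambda>z. YY i z * YY j z) =
     of_real (\<alpha> i * \<alpha> j) * C (\<lambda>z. RR a z * RR b z) + of_real (\<alpha> i * (t1 * \<beta> j)) * C (\<lambda>z. RR a z * SS b z)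
     + of_real (\<alpha> j * (t1 * \<beta> i)) * C (\<lambda>z. RR b z * SS a z) + of_real (t1 * \<beta> i * (t1 * \<beta> j)) * C (\<lambda>z. SS a z * SS b z)"
proof -
  have "C (\<lambda>z. YY i z * YY j z) = C (\<lambda>z. of_real (\<alpha> i * \<alpha> j) * (RR a z * RR b z)
     + of_real (\<alpha> i * (t1 * \<beta> j)) * (RR a z * SS b z)
     + of_real (\<alpha> j * (t1 * \<beta> i)) * (RR b z * SS a z) + of_real (t1 * \<beta> i * (t1 * \<beta> j)) * (SS a z * SS b z))"
    unfolding a_def b_def by (intro C_cong) (simp add: Y_eq circle_nonzero algebra_simps)
  also have "\<dots> = of_real (\<alpha> i * \<alpha> j) * C (\<lambda>z. RR a z * RR b z) + of_real (\<alpha> i * (t1 * \<beta> j)) * C (\<lambda>z. RR a z * SS b z)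
     + of_real (\<alpha> j * (t1 * \<beta> i)) * C (\<lambda>z. RR b z * SS a z) + of_real (t1 * \<beta> i * (t1 * \<beta> j)) * C (\<lambda>z. SS a z * SS b z)"
    by (subst C_add C_mult; (intro continuous_intros R_continuous S_continuous)?)+ auto
  finally show ?thesis .
qed

lemma C_S_0: "C (\<lambda>z. f z * SS 0 z) = 0" "C (\<lambda>z. SS 0 z * f z) = 0"
  by (simp_all add: S_def C_def)

lemma C_R_S_offdiag:
  assumes "a \<noteq> b"
  shows "of_real t1 * C (\<lambda>z. RR a z * SS b z) = 0"
proof (cases b)
  case (Suc k)
  show ?thesis
  proof (cases a)
    case (Suc m)
    then show ?thesis
      using G_offdiag[of m k] assms \<open>b = Suc k\<close> by (auto simp: C_R_S)
  qed (simp add: Suc C_R0_S)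
qed (simp add: C_S_0)

lemma C_R_R_offdiag:
  assumes "a \<noteq> b"
  shows "C (\<lambda>z. RR a z * RR b z) = 0"
proof -
  have *: "C (\<lambda>z. RR a z * RR (Suc m) z) = 0" if "a \<noteq> Suc m" for a m
    using C_R_R[of a m] C_R_S_offdiag[OF that] K_neq_0
    by auto
  show ?thesis
  proof (cases b)
    case 0
    then obtain m where "a = Suc m" using assms by (cases a) auto
    then show ?thesis using *[of b m] 0 by (simp add: mult.commute)
  qed (use * assms in auto)
qed

lemma C_S_S_offdiag:
  assumes "a \<noteq> b"
  shows "of_real t1 * C (\<lambda>z. SS a z * SS b z) = 0"
proof (cases a)
  case (Suc m)
  show ?thesis
  proof (cases b)
    case (Suc k)
    then show ?thesis
      using G_offdiag[of m k] assms \<open>a = Suc m\<close> by (auto simp: C_S_S)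
  qed (simp add: C_S_0)
qed (simp add: C_S_0)

text \<open>All pairings in the expansion \<open>C_Y_Y\<close> are explicit multiples of
  \<open>G m m\<close>; the total multiple \<open>?s\<close> is identically zero.\<close>

lemma C_Y_opposite: "C (\<lambda>z. YY (int (Suc m)) z * YY (- int (Suc m)) z) = 0"
proof -
  let ?i = "int (Suc m)" and ?t = "t1 * t2 * t3 * t4"
  define x where "x = q ^ m"
  define l where "l = lam (Suc m)"
  have n: "nat \<bar>?i\<bar> = Suc m" "nat \<bar>- ?i\<bar> = Suc m" by simp_all
  have qx: "q powi (- int (Suc m)) = 1 / (q * x)"
    using q_powi_Suc[of m] q by (simp add: power_int_minus x_def field_simps)
  have l: "l = (1 - 1 / (q * x)) * (1 - ?t * x)"
    unfolding l_def lam_def qx by (simp add: x_def)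
  have ab: "\<alpha> ?i = q * x * K" "\<beta> ?i = 1 - q * x" "\<alpha> (- ?i) = x * t3 * t4 * K" "\<beta> (- ?i) = - (1 - ?t * x)"
    by (simp_all add: \<alpha>_def \<beta>_def x_def nat_add_distrib)
  have RR: "C (\<lambda>z. RR (Suc m) z * RR (Suc m) z) = of_real (t1 * (1 - t1 * t2) * (t1 * l / K) / (2 * K)) * G m m"
    using C_R_R[of "Suc m" m] K_nonzero unfolding C_R_S l_def[symmetric] by (simp add: field_simps)
  have RS: "C (\<lambda>z. RR (Suc m) z * SS (Suc m) z) = of_real (t1 * l / K / 2) * G m m"
    unfolding C_R_S l_def[symmetric] by simp
  have SS: "C (\<lambda>z. SS (Suc m) z * SS (Suc m) z) = of_real ((1 - t3 * t4 / q) / 2) * G m m"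
    unfolding C_S_S by simp
  have "x \<noteq> 0" using q by (simp add: x_def)
  have "(q * x * K * (x * t3 * t4 * K)) * (t1 * (1 - t1 * t2) * (t1 * l / K) / (2 * K))
     + (q * x * K * (t1 * - (1 - ?t * x))) * (t1 * l / K / 2)
     + (x * t3 * t4 * K * (t1 * (1 - q * x))) * (t1 * l / K / 2)
     + (t1 * (1 - q * x) * (t1 * - (1 - ?t * x))) * ((1 - t3 * t4 / q) / 2) = 0" (is "?s = 0")
  proof -
    have "?s = t1 * t1 / 2 * (l * (q * x * x * t3 * t4 * (1 - t1 * t2) - q * x * (1 - ?t * x) + x * t3 * t4 * (1 - q * x))
       - (1 - q * x) * (1 - ?t * x) * (1 - t3 * t4 / q))"
      using K_nonzero by (simp add: field_simps)
    \<comment> \<open>The bracket collapses to \<open>- q * x * (1 - t3 * t4 / q)\<close>, while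
      \<open>l\<close> equals \<open>- (1 - q * x) * (1 - ?t * x) / (q * x)\<close>.\<close>
    also have "l * (q * x * x * t3 * t4 * (1 - t1 * t2) - q * x * (1 - ?t * x) + x * t3 * t4 * (1 - q * x))
        = (1 - q * x) * (1 - ?t * x) * (1 - t3 * t4 / q)"
      unfolding l using \<open>x \<noteq> 0\<close> q by (simp add: field_simps)
    finally show ?thesis by simp
  qed
  then show ?thesis
    unfolding C_Y_Y n ab RR RS SS mult.assoc[of _ _ "G m m", symmetric]
      of_real_mult[symmetric] distrib_right[symmetric] of_real_add[symmetric]
    by (simp only:) simp
qed

lemma C_Y_orthogonal:
  assumes "i \<noteq> j"
  shows "C (\<lambda>z. YY i z * YY j z) = 0"
proof (cases "nat \<bar>i\<bar> = nat \<bar>j\<bar>")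
  case False
  then have "nat \<bar>j\<bar> \<noteq> nat \<bar>i\<bar>" by simp
  have *: "of_real (x * (t1 * y)) * c = 0" "of_real (t1 * y * (t1 * x)) * c = 0" if "of_real t1 * c = 0" for x y and c :: complex
    using that by auto
  show ?thesis
    unfolding C_Y_Y C_R_R_offdiag[OF False] *(1)[OF C_R_S_offdiag[OF False]]
      *(1)[OF C_R_S_offdiag[OF \<open>nat \<bar>j\<bar> \<noteq> nat \<bar>i\<bar>\<close>]] *(2)[OF C_S_S_offdiag[OF False]]
    by simp
next
  case True
  then have "j = - i" "i \<noteq> 0" using assms by auto
  show ?thesis
  proof (cases "i > 0")
    case True
    then obtain m where "i = int (Suc m)" by (metis zero_less_imp_eq_int Suc_pred)
    then show ?thesis using C_Y_opposite[of m] \<open>j = - i\<close> by simp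
  next
    case False
    then have "j > 0" using \<open>j = - i\<close> \<open>i \<noteq> 0\<close> by simp
    then obtain m where "j = int (Suc m)" by (metis zero_less_imp_eq_int Suc_pred)
    moreover have "i = - j" using \<open>j = - i\<close> by simp
    ultimately show ?thesis using C_Y_opposite[of m] by (simp add: mult.commute)
  qed
qed

lemma cher_Y_orthogonal:
  assumes "i \<noteq> j"
  shows "cher t1 t2 t3 t4 q (YY i) (YY j) = 0"
  using C_Y_orthogonal[OF assms] unfolding cher_def C_def by simp

end

section \<open>Leading coefficients and spanning\<close>

definition restrict_nonzero :: "(complex \<Rightarrow> complex) \<Rightarrow> complex \<Rightarrow> complex" where
  "restrict_nonzero f z = (if z = 0 then 0 else f z)"

text \<open>\<open>f\<close> is the Laurent polynomial \<open>p(z) / z^m\<close> with real coefficients; its extreme coefficients are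
  those of \<open>p\<close> at \<open>2 m\<close> and \<open>0\<close>.\<close>

definition laurent_rep :: "nat \<Rightarrow> complex poly \<Rightarrow> (complex \<Rightarrow> complex) \<Rightarrow> bool" where
  "laurent_rep m p f \<longleftrightarrow> degree p \<le> 2 * m \<and> (\<forall>i. coeff p i \<in> \<real>) \<and> (\<forall>z. z \<noteq> 0 \<longrightarrow> z ^ m * f z = poly p z)"

lemma sum_fun_apply: "(\<Sum>i\<in>A. f i) x = (\<Sum>i\<in>A. f i x)"
  by (induction A rule: infinite_finite_induct) auto

lemma laurent_monom_in_V: "\<bar>k\<bar> \<le> int n \<Longrightarrow> laurent_monom k \<in> V n"
  unfolding V_def by (intro span_base imageI) auto

lemma V_mono: "m \<le> n \<Longrightarrow> V m \<subseteq> V n"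
  unfolding V_def by (intro span_mono image_mono) auto

text \<open>\<open>V\<close> is a real span, so the scalars are real parts; they lose nothing
  because the coefficients of \<open>p\<close> are real. \<open>restrict_nonzero\<close> supplies
  the value 0 at 0 that \<open>laurent_monom\<close> prescribes.\<close>

lemma laurent_rep_sum:
  assumes "laurent_rep m p f"
  shows "restrict_nonzero f = (\<Sum>i\<le>2*m. Re (coeff p i) *\<^sub>R laurent_monom (int i - int m))"
proof
  fix z :: complex
  show "restrict_nonzero f z = (\<Sum>i\<le>2*m. Re (coeff p i) *\<^sub>R laurent_monom (int i - int m)) z"
  proof (cases "z = 0")
    case True
    then show ?thesis
      by (simp add: restrict_nonzero_def sum_fun_apply scaleR_fun_def laurent_monom_def)
  next
    case False
    have c: "of_real (Re (coeff p i)) = coeff p i" for i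
      using assms by (simp add: laurent_rep_def)
    have "poly p z = (\<Sum>i\<le>2*m. coeff p i * z ^ i)"
      unfolding poly_altdef using assms
      by (intro sum.mono_neutral_left) (auto simp: laurent_rep_def coeff_eq_0)
    then have "z ^ m * f z = (\<Sum>i\<le>2*m. coeff p i * z ^ i)"
      using assms False by (simp add: laurent_rep_def)
    then have "f z = (\<Sum>i\<le>2*m. coeff p i * z ^ i) / z ^ m"
      using False by (simp add: field_simps)
    also have "\<dots> = (\<Sum>i\<le>2*m. coeff p i * z powi (int i - int m))"
      using False by (simp add: sum_divide_distrib power_int_diff)
    finally show ?thesis
      using False by (simp add: restrict_nonzero_def sum_fun_apply scaleR_fun_def laurent_monom_def
          scaleR_conv_of_real c)
  qed
qed

lemma laurent_rep_V:
  assumes "laurent_rep m p f"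
  shows "restrict_nonzero f \<in> V m"
  unfolding laurent_rep_sum[OF assms] V_def
  by (intro span_sum span_scale span_base imageI) auto

text \<open>Splitting the first and last terms off the expansion leaves exponents from
  \<open>- m\<close> to \<open>m\<close>, so modulo \<open>V m\<close> only the extreme coefficients
  matter.\<close>

lemma laurent_rep_lead:
  assumes "laurent_rep (Suc m) p f"
  shows "restrict_nonzero f - (Re (coeff p (2 * Suc m)) *\<^sub>R laurent_monom (int (Suc m))
     + Re (coeff p 0) *\<^sub>R laurent_monom (- int (Suc m))) \<in> V m"
proof -
  define g where "g i = Re (coeff p i) *\<^sub>R laurent_monom (int i - int (Suc m))" for i
  have "restrict_nonzero f = (\<Sum>i\<le>Suc (Suc (2 * m)). g i)"
    using laurent_rep_sum[OF assms] by (simp add: g_def)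
  also have "\<dots> = g 0 + (\<Sum>i\<le>2*m. g (Suc i)) + g (Suc (Suc (2 * m)))"
    by (simp only: sum.atMost_Suc[of g "Suc (2 * m)"] sum.atMost_Suc_shift[of g "2 * m"])
  finally have "restrict_nonzero f = Re (coeff p 0) *\<^sub>R laurent_monom (- int (Suc m))
     + (\<Sum>i\<le>2*m. Re (coeff p (Suc i)) *\<^sub>R laurent_monom (int (Suc i) - int (Suc m)))
     + Re (coeff p (2 * Suc m)) *\<^sub>R laurent_monom (int (Suc (Suc (2 * m))) - int (Suc m))"
    by (simp add: g_def)
  also have "int (Suc (Suc (2 * m))) - int (Suc m) = int (Suc m)" by simp
  finally have "restrict_nonzero f - (Re (coeff p (2 * Suc m)) *\<^sub>R laurent_monom (int (Suc m))
     + Re (coeff p 0) *\<^sub>R laurent_monom (- int (Suc m)))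
     = (\<Sum>i\<le>2*m. Re (coeff p (Suc i)) *\<^sub>R laurent_monom (int (Suc i) - int (Suc m)))"
    by (simp only: algebra_simps)
  also have "\<dots> \<in> V m"
    unfolding V_def by (intro span_sum span_scale span_base imageI) auto
  finally show ?thesis .
qed

text \<open>The multiplier turns \<open>p\<close> into \<open>p\<close> times a quadratic. The
  recursions of \<open>phi\<close> and \<open>psi\<close> and the passage from \<open>P\<close> to
  \<open>S\<close> all have this form.\<close>

lemma laurent_rep_mult:
  fixes a b c :: real
  assumes "laurent_rep m p f" "\<And>z. z \<noteq> 0 \<Longrightarrow> g z = (of_real a * z + of_real b + of_real c / z) * f z"
  shows "\<exists>p'. laurent_rep (Suc m) p' g \<and> coeff p' (2 * Suc m) = of_real a * coeff p (2 * m)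
    \<and> coeff p' 0 = of_real c * coeff p 0"
proof -
  define p' where "p' = p * [:of_real c, of_real b, of_real a:]"
  have p': "p' = smult (of_real c) p + pCons 0 (smult (of_real b) p + pCons 0 (smult (of_real a) p))"
    unfolding p'_def by (simp add: mult.commute[of p])
  have deg: "degree p \<le> 2 * m" using assms by (simp add: laurent_rep_def)
  have "degree p' \<le> degree p + degree [:of_real c, of_real b, of_real a :: complex:]"
    unfolding p'_def by (rule degree_mult_le)
  also have "\<dots> \<le> 2 * m + 2" using deg by (intro add_mono) (auto simp: degree_pCons_eq_if)
  finally have "degree p' \<le> 2 * Suc m" by simp
  moreover have "coeff p' i \<in> \<real>" for i
    using assms(1) unfolding p' laurent_rep_def
    by (auto simp: coeff_pCons split: nat.split intro!: Reals_add Reals_mult)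
  moreover have "z ^ Suc m * g z = poly p' z" if "z \<noteq> 0" for z
  proof -
    have "z ^ Suc m * g z = (z * (of_real a * z + of_real b + of_real c / z)) * (z ^ m * f z)"
      using assms(2)[OF that] by simp
    also have "z * (of_real a * z + of_real b + of_real c / z) = poly [:of_real c, of_real b, of_real a:] z"
      using that by (simp add: field_simps)
    also have "z ^ m * f z = poly p z" using assms(1) that by (simp add: laurent_rep_def)
    finally show ?thesis by (simp add: p'_def algebra_simps)
  qed
  moreover have "coeff p' (2 * Suc m) = of_real a * coeff p (2 * m)"
    using deg unfolding p' by (simp add: coeff_eq_0)
  moreover have "coeff p' 0 = of_real c * coeff p 0"
    unfolding p' by simp
  ultimately show ?thesis unfolding laurent_rep_def by blast
qed

lemma laurent_rep_lincomb:
  fixes a b :: real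
  assumes "laurent_rep m p f" "laurent_rep m p' g" "\<And>z. z \<noteq> 0 \<Longrightarrow> h z = of_real a * f z + of_real b * g z"
  shows "laurent_rep m (smult (of_real a) p + smult (of_real b) p') h"
  using assms unfolding laurent_rep_def
  by (auto intro!: degree_add_le order.trans[OF degree_smult_le] Reals_add Reals_mult simp: algebra_simps)

text \<open>Only the last summand reaches the exponents \<open>m\<close> and
  \<open>- m\<close>.\<close>

lemma laurent_rep_sum_triangular:
  fixes c :: "nat \<Rightarrow> real"
  assumes "\<And>k. laurent_rep k (p k) (f k)"
  shows "\<exists>p'. laurent_rep m p' (\<lambda>z. \<Sum>k\<le>m. of_real (c k) * f k z)
     \<and> coeff p' (2 * m) = of_real (c m) * coeff (p m) (2 * m)
     \<and> coeff p' 0 = of_real (c m) * coeff (p m) 0"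
proof (induction m)
  case 0
  show ?case
    using assms[of 0] by (intro exI[of _ "smult (of_real (c 0)) (p 0)"]) (auto simp: laurent_rep_def Reals_mult)
next
  case (Suc m)
  then obtain p1 where "laurent_rep m p1 (\<lambda>z. \<Sum>k\<le>m. of_real (c k) * f k z)" by blast
  \<comment> \<open>Multiplying by \<open>0 * z + 1 + 0 / z\<close> re-represents the same function
    at level \<open>Suc m\<close>, with both extreme coefficients 0.\<close>
  then obtain p2 where p2: "laurent_rep (Suc m) p2 (\<lambda>z. \<Sum>k\<le>m. of_real (c k) * f k z)"
    "coeff p2 (2 * Suc m) = 0" "coeff p2 0 = 0"
    using laurent_rep_mult[of m p1 _ "\<lambda>z. \<Sum>k\<le>m. of_real (c k) * f k z" 0 1 0] by auto
  have "laurent_rep (Suc m) (smult (of_real 1) p2 + smult (of_real (c (Suc m))) (p (Suc m)))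
    (\<lambda>z. \<Sum>k\<le>Suc m. of_real (c k) * f k z)"
    by (rule laurent_rep_lincomb[OF p2(1) assms]) simp
  then show ?case using p2(2,3) by (intro exI[of _ "smult (of_real 1) p2 + smult (of_real (c (Suc m))) (p (Suc m))"]) auto
qed

text \<open>Multiplied by \<open>z ^ n\<close>, the relation is a polynomial vanishing at every
  nonzero point.\<close>

lemma laurent_monom_sum_eq_0:
  fixes c :: "int \<Rightarrow> real"
  assumes "(\<Sum>k\<in>{- int n..int n}. c k *\<^sub>R laurent_monom k) = 0" "k \<in> {- int n..int n}"
  shows "c k = 0"
proof (rule ccontr)
  assume "c k \<noteq> 0"
  define b :: "nat \<Rightarrow> complex" where "b i = of_real (c (int i - int n))" for i
  have k: "\<exists>i\<le>2 * n. b i \<noteq> 0"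
    using \<open>c k \<noteq> 0\<close> assms(2) by (intro exI[of _ "nat (k + int n)"]) (auto simp: b_def)
  have "(\<Sum>i\<le>2*n. b i * z ^ i) = 0" if "z \<noteq> 0" for z
  proof -
    have "(\<Sum>i\<le>2*n. b i * z ^ i) = z ^ n * (\<Sum>i\<le>2*n. b i * z powi (int i - int n))"
      using that by (simp add: sum_distrib_left power_int_diff)
    also have "(\<Sum>i\<le>2*n. b i * z powi (int i - int n)) = (\<Sum>k\<in>{- int n..int n}. of_real (c k) * z powi k)"
      unfolding b_def
      by (intro sum.reindex_bij_witness[of _ "\<lambda>k. nat (k + int n)" "\<lambda>i. int i - int n"]) auto
    also have "\<dots> = (\<Sum>k\<in>{- int n..int n}. c k *\<^sub>R laurent_monom k) z"
      using that by (simp add: sum_fun_apply scaleR_fun_def laurent_monom_def scaleR_conv_of_real)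
    also have "\<dots> = 0" by (simp add: assms(1))
    finally show ?thesis by simp
  qed
  then have "- {0} \<subseteq> {z. (\<Sum>i\<le>2*n. b i * z ^ i) = 0}" by auto
  moreover have "finite {z. (\<Sum>i\<le>2*n. b i * z ^ i) = 0}"
    using polyfun_rootbound[OF k] by blast
  ultimately have "finite (- {0 :: complex})" by (rule finite_subset)
  then show False using infinite_UNIV_char_0[where 'a = complex] by simp
qed

lemma inj_laurent_monom: "inj laurent_monom"
proof
  fix j k :: int
  assume "laurent_monom j = laurent_monom k"
  then have "laurent_monom j 2 = laurent_monom k 2" by simp
  then have "norm ((2 :: complex) powi j) = norm ((2 :: complex) powi k)" by (simp add: laurent_monom_def)
  then have "(2 :: real) powi j = 2 powi k" by (simp add: norm_power_int)
  then show "j = k"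
    by (metis linorder_less_linear order_less_irrefl power_int_strict_increasing one_less_numeral_iff semiring_norm(76))
qed

lemma independent_laurent_monom: "independent (laurent_monom ` {- int n..int n})"
proof
  assume "dependent (laurent_monom ` {- int n..int n})"
  then obtain u where u: "\<exists>v\<in>laurent_monom ` {- int n..int n}. u v \<noteq> 0"
    "(\<Sum>v\<in>laurent_monom ` {- int n..int n}. u v *\<^sub>R v) = 0"
    by (subst (asm) dependent_finite) auto
  have "(\<Sum>k\<in>{- int n..int n}. u (laurent_monom k) *\<^sub>R laurent_monom k) = 0"
    using u(2) by (subst (asm) sum.reindex) (auto intro: inj_on_subset[OF inj_laurent_monom])
  from laurent_monom_sum_eq_0[OF this] u(1) show False by auto
qed

section \<open>Extreme coefficients of \<open>R\<close> and \<open>S\<close>\<close>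

context aw_params
begin

text \<open>With \<open>a = t1 * q ^ k\<close>, each step multiplies by
  \<open>(1 - a * z) * (1 - a / z)\<close>, contributing \<open>- a\<close> at both ends.\<close>

lemma phi_rep: "\<exists>p. laurent_rep k p (phi k) \<and> coeff p (2 * k) = of_real (\<Prod>i<k. - (t1 * q ^ i))
    \<and> coeff p 0 = of_real (\<Prod>i<k. - (t1 * q ^ i))"
proof (induction k)
  case 0
  show ?case by (intro exI[of _ 1]) (auto simp: laurent_rep_def phi_def)
next
  case (Suc k)
  then obtain p where p: "laurent_rep k p (phi k)" "coeff p (2 * k) = of_real (\<Prod>i<k. - (t1 * q ^ i))"
    "coeff p 0 = of_real (\<Prod>i<k. - (t1 * q ^ i))" by blast
  define a where "a = t1 * q ^ k"
  have "phi (Suc k) z = (of_real (- a) * z + of_real (1 + a * a) + of_real (- a) / z) * phi k z" if "z \<noteq> 0" for z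
  proof -
    have "phi (Suc k) z = ((1 - of_real a * z) * (1 - of_real a / z)) * phi k z"
      by (simp add: phi_def qpoch_Suc a_def mult_ac)
    also have "(1 - of_real a * z) * (1 - of_real a / z) = of_real (- a) * z + of_real (1 + a * a) + of_real (- a) / z"
      using that by (simp add: field_simps)
    finally show ?thesis .
  qed
  from laurent_rep_mult[OF p(1) this] show ?case
    unfolding p(2,3) by (simp add: a_def mult_ac)
qed

text \<open>Here the step factor is \<open>(1 - a * z) * (1 - q * a / z)\<close>; the extra
  \<open>q\<close> at the lower end accumulates to \<open>q ^ k\<close>.\<close>

lemma psi_rep: "\<exists>p. laurent_rep k p (psi k) \<and> coeff p (2 * k) = of_real (\<Prod>i<k. - (t1 * q ^ i))
    \<and> coeff p 0 = of_real (q ^ k * (\<Prod>i<k. - (t1 * q ^ i)))"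
proof (induction k)
  case 0
  show ?case by (intro exI[of _ 1]) (auto simp: laurent_rep_def psi_def)
next
  case (Suc k)
  then obtain p where p: "laurent_rep k p (psi k)" "coeff p (2 * k) = of_real (\<Prod>i<k. - (t1 * q ^ i))"
    "coeff p 0 = of_real (q ^ k * (\<Prod>i<k. - (t1 * q ^ i)))" by blast
  define a where "a = t1 * q ^ k"
  have "psi (Suc k) z = (of_real (- a) * z + of_real (1 + q * a * a) + of_real (- (q * a)) / z) * psi k z" if "z \<noteq> 0" for z
  proof -
    have "psi (Suc k) z = ((1 - of_real a * z) * (1 - of_real (q * a) / z)) * psi k z"
      by (simp add: psi_def qpoch_Suc a_def mult_ac)
    also have "(1 - of_real a * z) * (1 - of_real (q * a) / z) = of_real (- a) * z + of_real (1 + q * a * a) + of_real (- (q * a)) / z"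
      using that by (simp add: field_simps)
    finally show ?thesis .
  qed
  from laurent_rep_mult[OF p(1) this] show ?case
    unfolding p(2,3) by (simp add: a_def mult_ac)
qed

definition R_lead :: "nat \<Rightarrow> real" where
  "R_lead m = R_coeff m m * (\<Prod>i<m. - (t1 * q ^ i))"

text \<open>The index is that of \<open>P\<close>: this is the top coefficient of
  \<open>P m\<close>, hence of \<open>SS (Suc m)\<close>.\<close>

definition S_lead :: "nat \<Rightarrow> real" where
  "S_lead m = P_coeff m m * (\<Prod>i<m. - (t1 * q ^ i))"

lemma R_rep: "\<exists>p. laurent_rep m p (RR m) \<and> coeff p (2 * m) = of_real (R_lead m) \<and> coeff p 0 = of_real (R_lead m)"
proof -
  obtain p where p: "\<And>k. laurent_rep k (p k) (phi k) \<and> coeff (p k) (2 * k) = of_real (\<Prod>i<k. - (t1 * q ^ i))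
    \<and> coeff (p k) 0 = of_real (\<Prod>i<k. - (t1 * q ^ i))"
    using phi_rep by metis
  then have "laurent_rep k (p k) (phi k)" for k by blast
  from laurent_rep_sum_triangular[of p phi m "R_coeff m", OF this] p[of m]
  show ?thesis unfolding R_eq[abs_def] R_lead_def by (simp only: of_real_mult)
qed

lemma P_rep: "\<exists>p. laurent_rep m p (P m) \<and> coeff p (2 * m) = of_real (S_lead m) \<and> coeff p 0 = of_real (q ^ m * S_lead m)"
proof -
  obtain p where p: "\<And>k. laurent_rep k (p k) (psi k) \<and> coeff (p k) (2 * k) = of_real (\<Prod>i<k. - (t1 * q ^ i))
    \<and> coeff (p k) 0 = of_real (q ^ k * (\<Prod>i<k. - (t1 * q ^ i)))"
    using psi_rep by metis
  then have "laurent_rep k (p k) (psi k)" for k by blast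
  from laurent_rep_sum_triangular[of p psi m "P_coeff m", OF this] p[of m]
  show ?thesis unfolding P_def[abs_def] S_lead_def
    by (simp only: of_real_mult mult.left_commute[of "of_real (q ^ m)"])
qed

text \<open>Multiplication by \<open>d = z - (t3 + t4) + t3 * t4 / z\<close> keeps the top
  coefficient and multiplies the bottom one by \<open>t3 * t4\<close>.\<close>

lemma S_rep: "\<exists>p. laurent_rep (Suc m) p (SS (Suc m)) \<and> coeff p (2 * Suc m) = of_real (S_lead m)
   \<and> coeff p 0 = of_real (t3 * t4 * q ^ m * S_lead m)"
proof -
  obtain p where p: "laurent_rep m p (P m)" "coeff p (2 * m) = of_real (S_lead m)" "coeff p 0 = of_real (q ^ m * S_lead m)"
    using P_rep by blast
  have "SS (Suc m) z = (of_real 1 * z + of_real (- (t3 + t4)) + of_real (t3 * t4) / z) * P m z" if "z \<noteq> 0" for z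
    unfolding S_Suc[OF that] d_def using that by (simp add: field_simps)
  from laurent_rep_mult[OF p(1) this] show ?thesis
    unfolding p(2,3) by (simp add: mult_ac)
qed

lemma Y_in_V:
  assumes "i \<in> {- int n..int n}"
  shows "YY i \<in> V n"
proof -
  let ?a = "nat \<bar>i\<bar>"
  have "\<exists>p. laurent_rep ?a p (SS ?a)"
  proof (cases ?a)
    case 0
    then show ?thesis by (intro exI[of _ 0]) (simp add: laurent_rep_def S_def)
  qed (use S_rep in metis)
  then obtain p p' where "laurent_rep ?a p (RR ?a)" "laurent_rep ?a p' (SS ?a)"
    using R_rep by blast
  from laurent_rep_lincomb[OF this Y_eq] have "restrict_nonzero (YY i) \<in> V ?a"
    by (rule laurent_rep_V)
  moreover have "restrict_nonzero (YY i) = YY i"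
    by (auto simp: restrict_nonzero_def Y_def fun_eq_iff)
  moreover have "?a \<le> n" using assms by auto
  ultimately show ?thesis using V_mono by auto
qed

section \<open>Nonvanishing of the extreme coefficients, spanning and the basis\<close>

lemma qpoch_q_neg_nonzero: "qpoch (q powi (- int m)) q m \<noteq> 0"
proof -
  have "q powi (- int m) * q ^ i \<noteq> 1" if "i < m" for i
  proof
    assume "q powi (- int m) * q ^ i = 1"
    then have "q ^ i = q ^ m" using q by (simp add: power_int_minus field_simps)
    moreover have "q ^ m < q ^ i" using that q by (intro power_strict_decreasing) auto
    ultimately show False by simp
  qed
  then show ?thesis unfolding qpoch_def by (auto simp: prod_zero_iff)
qed

lemma qpoch_t_nonzero: "qpoch (t1 * t2 * t3 * t4 * q ^ j) q k \<noteq> 0"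
  using t_all_pow by (auto simp: qpoch_def prod_zero_iff mult.assoc simp flip: power_add)

lemma R_lead_nonzero: "t1 \<noteq> 0 \<Longrightarrow> R_lead (Suc m) \<noteq> 0"
proof -
  assume "t1 \<noteq> 0"
  moreover have "q powi (int (Suc m) - 1) = q ^ m" by simp
  moreover have "qpoch q q k \<noteq> 0" for k using q by (intro qpoch_nonzero) auto
  ultimately show ?thesis
    using q qpoch_q_neg_nonzero[of "Suc m"] qpoch_t_nonzero[of m "Suc m"]
      t_pair[THEN qpoch_t_shift(3), of "Suc m"]
    unfolding R_lead_def R_coeff_def by (simp add: prod_zero_iff del: of_nat_Suc)
qed

lemma S_lead_nonzero: "t1 \<noteq> 0 \<Longrightarrow> S_lead m \<noteq> 0"
proof -
  assume "t1 \<noteq> 0"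
  moreover have "qpoch q q k \<noteq> 0" for k using q by (intro qpoch_nonzero) auto
  ultimately show ?thesis
    using q qpoch_q_neg_nonzero[of m] qpoch_t_nonzero[of "Suc m" m] t_pair[THEN qpoch_t_shift(2), of m]
    by (simp add: S_lead_def P_coeff_def prod_zero_iff mult.assoc)
qed

text \<open>Induction on \<open>m\<close>. The hypothesis makes the coefficient of \<open>S\<close>
  in \<open>Y_relation\<close> nonzero, so the span contains \<open>S\<close>, and then
  \<open>R\<close>, at index \<open>Suc m\<close>. Modulo \<open>V m\<close> these are multiples of
  \<open>?u + ?v\<close> and \<open>?u + (t3 * t4 * q ^ m) *\<^sub>R ?v\<close>, from which both
  monomials are recovered.\<close>

lemma V_subset_span_Y:
  assumes "\<forall>m\<in>{1..n}. t1 \<noteq> 0 \<and> t3 * t4 * (1 - q ^ m) + q * (1 - t1 * t2 * t3 * t4 * q ^ (m - 1)) \<noteq> 0"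
    and "m \<le> n"
  shows "V m \<subseteq> span (YY ` {- int m..int m})"
  using assms(2)
proof (induction m)
  case 0
  have "YY 0 = K *\<^sub>R laurent_monom 0"
    by (auto simp: fun_eq_iff Y_def Let_def K_def R_0 S_def scaleR_fun_def laurent_monom_def scaleR_conv_of_real)
  then have "laurent_monom 0 = (1 / K) *\<^sub>R YY 0" using K_nonzero by simp
  then have "laurent_monom 0 \<in> span (YY ` {- int 0..int 0})"
    by (simp add: span_scale span_base)
  then show ?case unfolding V_def by (intro span_minimal) auto
next
  case (Suc m)
  let ?M = "int (Suc m)"
  define U where "U = span (YY ` {- ?M..?M})"
  have U: "subspace U" by (simp add: U_def)
  define r where "r = restrict_nonzero (RR (Suc m))"
  define s where "s = restrict_nonzero (SS (Suc m))"
  have scaled: "f \<in> U" if "c *\<^sub>R f \<in> U" "c \<noteq> 0" for c f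
  proof -
    have "(1 / c) *\<^sub>R (c *\<^sub>R f) \<in> U" by (rule subspace_scale[OF U that(1)])
    then show ?thesis using that(2) by simp
  qed
  have VU: "V m \<subseteq> U"
  proof -
    have "span (YY ` {- int m..int m}) \<subseteq> U" unfolding U_def by (intro span_mono image_mono) auto
    then show ?thesis using Suc by auto
  qed
  have t1: "t1 \<noteq> 0" and nd: "t3 * t4 * (1 - q ^ Suc m) + q * (1 - t1 * t2 * t3 * t4 * q ^ m) \<noteq> 0"
    using assms(1) Suc.prems by (auto dest!: bspec[of _ _ "Suc m"] simp del: power_Suc)
  have Y: "YY ?M \<in> U" "YY (- ?M) \<in> U"
    unfolding U_def by (intro span_base imageI; simp)+
  have "(t1 * (t3 * t4 * (1 - q ^ Suc m) + q * (1 - t1 * t2 * t3 * t4 * q ^ m))) *\<^sub>R s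
      = (t3 * t4) *\<^sub>R YY ?M - q *\<^sub>R YY (- ?M)"
  proof
    fix z :: complex
    show "((t1 * (t3 * t4 * (1 - q ^ Suc m) + q * (1 - t1 * t2 * t3 * t4 * q ^ m))) *\<^sub>R s) z
      = ((t3 * t4) *\<^sub>R YY ?M - q *\<^sub>R YY (- ?M)) z"
      using Y_relation[of "Suc m" z t3 t4 t1 t2 q]
      by (cases "z = 0") (simp_all add: scaleR_fun_def s_def restrict_nonzero_def scaleR_conv_of_real Y_def
         del: of_nat_Suc of_real_mult of_real_add of_real_diff power_Suc)
  qed
  then have s: "s \<in> U"
    using Y t1 nd by (intro scaled[of "t1 * (t3 * t4 * (1 - q ^ Suc m) + q * (1 - t1 * t2 * t3 * t4 * q ^ m))" s])
      (auto intro!: subspace_diff[OF U] subspace_scale[OF U] simp del: of_nat_Suc power_Suc)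
  have "(q ^ Suc m * K) *\<^sub>R r = YY ?M - (t1 * (1 - q ^ Suc m)) *\<^sub>R s"
  proof
    fix z :: complex
    have M: "nat \<bar>?M\<bar> = Suc m" "\<alpha> ?M = q ^ Suc m * K" "\<beta> ?M = 1 - q ^ Suc m"
      by (simp_all add: \<alpha>_def \<beta>_def nat_add_distrib)
    show "((q ^ Suc m * K) *\<^sub>R r) z = (YY ?M - (t1 * (1 - q ^ Suc m)) *\<^sub>R s) z"
    proof (cases "z = 0")
      case False
      then show ?thesis
        unfolding fun_diff_def Y_eq[OF False] M
        by (simp add: scaleR_fun_def r_def s_def restrict_nonzero_def scaleR_conv_of_real
            del: of_nat_Suc of_real_mult of_real_diff power_Suc)
    qed (simp add: scaleR_fun_def r_def s_def restrict_nonzero_def Y_def)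
  qed
  then have r: "r \<in> U"
    using Y s q K_nonzero by (intro scaled[of "q ^ Suc m * K" r]) (auto intro!: subspace_diff[OF U] subspace_scale[OF U])
  let ?u = "laurent_monom ?M" and ?v = "laurent_monom (- ?M)"
  obtain p where p: "laurent_rep (Suc m) p (RR (Suc m))" "coeff p (2 * Suc m) = of_real (R_lead (Suc m))"
    "coeff p 0 = of_real (R_lead (Suc m))" using R_rep by blast
  have "r - (R_lead (Suc m) *\<^sub>R ?u + R_lead (Suc m) *\<^sub>R ?v) \<in> U"
    using laurent_rep_lead[OF p(1)] VU unfolding p(2,3) r_def by auto
  from subspace_diff[OF U r this] have "R_lead (Suc m) *\<^sub>R (?u + ?v) \<in> U"
    by (simp add: scaleR_add_right del: of_nat_Suc)
  then have uv: "?u + ?v \<in> U" using R_lead_nonzero[OF t1] by (rule scaled)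
  obtain p' where p': "laurent_rep (Suc m) p' (SS (Suc m))" "coeff p' (2 * Suc m) = of_real (S_lead m)"
    "coeff p' 0 = of_real (t3 * t4 * q ^ m * S_lead m)" using S_rep by blast
  have "s - (S_lead m *\<^sub>R ?u + (t3 * t4 * q ^ m * S_lead m) *\<^sub>R ?v) \<in> U"
    using laurent_rep_lead[OF p'(1)] VU unfolding p'(2,3) s_def Re_complex_of_real by auto
  from subspace_diff[OF U s this] have "S_lead m *\<^sub>R (?u + (t3 * t4 * q ^ m) *\<^sub>R ?v) \<in> U"
    by (simp add: scaleR_add_right mult_ac del: of_nat_Suc)
  then have "?u + (t3 * t4 * q ^ m) *\<^sub>R ?v \<in> U" using S_lead_nonzero[OF t1] by (rule scaled)
  \<comment> \<open>The two combinations are independent because their determinant is, up to sign,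
    \<open>1 - t3 * t4 * q ^ m\<close>, nonzero as \<open>\<bar>t3 * t4\<bar> < 1\<close>.\<close>
  from subspace_diff[OF U uv this] have "(1 - t3 * t4 * q ^ m) *\<^sub>R ?v \<in> U"
    by (simp add: scaleR_diff_left del: of_nat_Suc)
  moreover have "\<bar>t3 * t4 * q ^ m\<bar> < 1" using t_pair q_pow[of m] by (intro abs_mult_less_1[where b = "q ^ m"]) auto
  then have "1 - t3 * t4 * q ^ m \<noteq> 0" by auto
  ultimately have v: "?v \<in> U" by (rule scaled)
  from subspace_diff[OF U uv v] have u: "?u \<in> U" by simp
  have "laurent_monom k \<in> U" if "k \<in> {- ?M..?M}" for k
  proof (cases "\<bar>k\<bar> \<le> int m")
    case True
    then show ?thesis using laurent_monom_in_V VU by blast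
  next
    case False
    then have "k = ?M \<or> k = - ?M" using that by auto
    then show ?thesis using u v by auto
  qed
  then show ?case unfolding V_def U_def[symmetric] by (intro span_minimal U) auto
qed

text \<open>Independence comes from counting, not from orthogonality, since nothing is known here
  about the values of the form on equal elements.\<close>

lemma orthogonal_basis_Y:
  assumes "\<forall>m\<in>{1..n}. t1 \<noteq> 0 \<and> t3 * t4 * (1 - q ^ m) + q * (1 - t1 * t2 * t3 * t4 * q ^ (m - 1)) \<noteq> 0"
  shows "orthogonal_basis (cher t1 t2 t3 t4 q) (V n) (YY ` {- int n..int n})"
proof -
  let ?B = "YY ` {- int n..int n}" and ?M = "laurent_monom ` {- int n..int n}"
  have "span ?B \<subseteq> V n"
    using Y_in_V unfolding V_def by (intro span_minimal) auto
  then have span: "span ?B = V n"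
    using V_subset_span_Y[OF assms order.refl] by auto
  have "independent ?B"
  proof
    assume "dependent ?B"
    then obtain f where f: "f \<in> ?B" "f \<in> span (?B - {f})" by (auto simp: dependent_def)
    \<comment> \<open>A redundant \<open>f\<close> would leave a spanning set with fewer elements
      than the \<open>2 * n + 1\<close> independent monomials.\<close>
    then have "V n = span (?B - {f})" using span span_redundant[OF f(2)] by (simp add: insert_absorb)
    moreover have "?M \<subseteq> V n" unfolding V_def by (rule span_superset)
    ultimately have "?M \<subseteq> span (?B - {f})" by simp
    from independent_span_bound[OF _ independent_laurent_monom this]
    have "card ?M \<le> card (?B - {f})" by simp
    also have "\<dots> < card ?B" using f(1) by (intro psubset_card_mono) auto
    also have "\<dots> \<le> card {- int n..int n}" by (intro card_image_le) simp
    also have "\<dots> = card ?M" by (intro card_image[symmetric] inj_on_subset[OF inj_laurent_monom]) simp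
    finally show False by simp
  qed
  moreover have "\<forall>f\<in>?B. \<forall>g\<in>?B. f \<noteq> g \<longrightarrow> cher t1 t2 t3 t4 q f g = 0"
    by (auto intro!: cher_Y_orthogonal)
  ultimately show ?thesis unfolding orthogonal_basis_def using span by blast
qed

end

text \<open>The condition on the basis claim says that the coefficient of \<open>S\<close> in
  \<open>Y_relation\<close> is nonzero for each \<open>m\<close> from 1 to \<open>n\<close>. Where
  it fails, that relation makes the two functions of index \<open>m\<close> and \<open>- m\<close>
  linearly dependent. Orthogonality is stated for distinct indices, hence also covers indices whose
  functions coincide.\<close>

theorem theorem4p5:
  fixes q t1 t2 t3 t4 :: real and n :: nat
  assumes "0 < q" "q < 1"
    and "\<bar>t1\<bar> < 1" "\<bar>t2\<bar> < 1" "\<bar>t3\<bar> < 1" "\<bar>t4\<bar> < 1"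
  shows "(\<forall>i\<in>{- int n..int n}. Y t1 t2 t3 t4 q i \<in> V n)
       \<and> (\<forall>i\<in>{- int n..int n}. \<forall>j\<in>{- int n..int n}. i \<noteq> j \<longrightarrow>
            cher t1 t2 t3 t4 q (Y t1 t2 t3 t4 q i) (Y t1 t2 t3 t4 q j) = 0)
       \<and> ((\<forall>m\<in>{1..n}. t1 \<noteq> 0 \<and>
              t3 * t4 * (1 - q ^ m) + q * (1 - t1 * t2 * t3 * t4 * q ^ (m - 1)) \<noteq> 0)
            \<longrightarrow> orthogonal_basis (cher t1 t2 t3 t4 q) (V n) (Y t1 t2 t3 t4 q ` {- int n..int n}))"
proof -
  interpret aw_params q t1 t2 t3 t4
    using assms by unfold_locales
  show ?thesis
  proof (intro conjI ballI impI)
    show "Y t1 t2 t3 t4 q i \<in> V n" if "i \<in> {- int n..int n}" for i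
      using that by (rule Y_in_V)
  qed (rule cher_Y_orthogonal orthogonal_basis_Y, assumption)+
qed

end
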